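(* For all bouquets $\Phi,\Psi$: if $\Phi\to^*\Psi$ in the full flower calculus $\mathsf N\cup\mathsf C$, then $\Psi\models\Phi$.
   Context: Fix a countable set $\mathcal{V}$ of variables and a first-order signature: a countable set $\mathcal{P}$ of predicate symbols with arities $\mathrm{ar}:\mathcal{P}\to\mathbb{N}$. Flowers and gardens by mutual induction: atoms $p(\vec x)$ ($\vec x\in\mathcal V^{\mathrm{ar}(p)}$) are flowers; if $\mathbf{x}\subset\mathcal{V}$ is finite (a sprinkler) and $\Phi$ a finite multiset of flowers (a bouquet), $\mathbf{x}\cdot\Phi$ is a garden; if $\gamma$ is a garden (pistil) and $\Delta$ a finite multiset of gardens (corolla of petals), $\gamma\rhd\Delta$ is a flower, also written $\gamma\rhd\delta_1;\dots;\delta_n$. $\emptyset\cdot\Phi$ is written $\Phi$; $\emptyset$ is the empty bouquet; comma is multiset union; $\mathbf x,\mathbf y$ denotes $\mathbf x\cup\mathbf y$. Free variables: $\mathrm{fv}(p(\vec x))$ = variables of $\vec x$; $\mathrm{fv}(\Phi)=\bigcup\mathrm{fv}(\phi)$; $\mathrm{fv}(\mathbf{x}\cdot\Phi)=\mathrm{fv}(\Phi)\setminus\mathbf{x}$; $\mathrm{fv}(\mathbf{x}\cdot\Phi\rhd\Delta)=\mathrm{fv}(\mathbf{x}\cdot\Phi)\cup\bigcup_{\mathbf{y}\cdot\Psi\in\Delta}\mathrm{fv}((\mathbf{x}\cup\mathbf{y})\cdot\Psi)$. Bound variables: $\mathrm{bv}(p(\vec x))=\emptyset$, $\mathrm{bv}(\Phi)=\bigcup\mathrm{bv}(\phi)$,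 $\mathrm{bv}(\mathbf x\cdot\Phi)=\mathbf x\cup\mathrm{bv}(\Phi)$, $\mathrm{bv}(\gamma\rhd\Delta)=\mathrm{bv}(\gamma)\cup\bigcup_{\delta\in\Delta}\mathrm{bv}(\delta)$. Standing convention: every bouquet considered has pairwise distinct binders and $\mathrm{bv}(\Phi)\cap\mathrm{fv}(\Phi)=\emptyset$. Substitutions: $f[R\mapsto g]$ equals $g$ on $R$ and $f$ elsewhere (left-associative; omitted function means identity). A substitution is $\sigma:\mathcal V\to\mathcal V$ with finite support; $\sigma:\mathbf y$ means support $\mathbf y$; $\sigma_{-\mathbf x}:=\sigma[\mathbf x\mapsto\mathrm{id}]$. Action: $\sigma(p(x_1,\dots,x_n))=p(\sigma(x_1),\dots,\sigma(x_n))$, elementwise on bouquets, $\sigma(\mathbf x\cdot\Phi)=\mathbf x\cdot\sigma_{-\mathbf x}(\Phi)$, $\sigma(\mathbf x\cdot\Phi\rhd\delta_1;\dots;\delta_n)=\sigma(\mathbf x\cdot\Phi)\rhd\sigma_{-\mathbf x}(\delta_1);\dots;\sigma_{-\mathbf x}(\delta_n)$. $\sigma:\mathbf y$ is capture-avoiding in $\Phi$ if $\sigma(\mathbf y)\cap\mathrm{bv}(\Phi)=\emptyset$. Contexts: $\Xi::=\Psi,\xi$, $\xi::=\Box\mid(\mathbf x\cdot\Xi\rhd\Delta)\mid(\gamma\rhd\mathbf x\cdot\Xi;\Delta)$; $\Xi\{\Psi\}$ fills the hole with bouquet $\Psi$, $\Xi\{\}$ with $\emptyset$. Inversions: $\mathrm{inv}(\Box)=0$,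 $\mathrm{inv}(\Psi,\xi)=\mathrm{inv}(\xi)$, $\mathrm{inv}(\mathbf x\cdot\Xi\rhd\Delta)=1+\mathrm{inv}(\Xi)$, $\mathrm{inv}(\gamma\rhd\mathbf x\cdot\Xi;\Delta)=\mathrm{inv}(\Xi)$; positive contexts $\Xi^+$ have even, negative $\Xi^-$ odd inversions. A flower $\phi$ can be pollinated in $\Xi$ if there are a bouquet $\Psi\ni\phi$ and contexts $\Xi',\Xi_0$ with $\Xi=\Xi'\{\Psi,\Xi_0\}$ or $\Xi=\Xi'\{\mathbf x\cdot\Psi\rhd\mathbf y\cdot\Xi_0;\Delta\}$; a bouquet can be pollinated if each of its flowers can. Rules (conclusion $\to$ premiss). Natural $\mathsf N$: (poll↓) $\Xi\{\Phi\}\to\Xi\{\}$, (poll↑) $\Xi\{\}\to\Xi\{\Phi\}$ when $\Phi$ can be pollinated in $\Xi$; (epis) $\Phi\to(\emptyset\cdot\emptyset\rhd\emptyset\cdot\Phi)$; (epet) $(\gamma\rhd\emptyset\cdot\emptyset;\Delta)\to\emptyset$; (srep) $(\mathbf x\cdot(\Phi,(\emptyset\cdot\emptyset\rhd\gamma_1;\dots;\gamma_n))\rhd\Delta)\to(\mathbf x\cdot\Phi\rhd\emptyset\cdot\{(\gamma_1\rhd\Delta),\dots,(\gamma_n\rhd\Delta)\})$; (ipis) $(\mathbf x,\mathbf y\cdot\Phi\rhd\Delta)\to(\mathbf x\cdot\sigma(\Phi)\rhd\sigma(\Delta)),(\mathbf x,\mathbf y\cdot\Phi\rhd\Delta)$;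 (ipet) $(\gamma\rhd\mathbf x,\mathbf y\cdot\Phi;\Delta)\to(\gamma\rhd\mathbf x\cdot\sigma(\Phi);\mathbf x,\mathbf y\cdot\Phi;\Delta)$. Cultural $\mathsf C$: (grow) $\Xi^+\{\}\to\Xi^+\{\Phi\}$; (crop) $\Xi^-\{\Phi\}\to\Xi^-\{\}$; (pull) $\Xi^+\{\gamma\rhd\Gamma;\Delta\}\to\Xi^+\{\gamma\rhd\Delta\}$; (glue) $\Xi^-\{\gamma\rhd\Delta\}\to\Xi^-\{\gamma\rhd\Gamma;\Delta\}$; (apis) $\Xi^+\{\mathbf x\cdot\sigma(\Phi)\rhd\sigma(\Delta)\}\to\Xi^+\{\mathbf x,\mathbf y\cdot\Phi\rhd\Delta\}$; (apet) $\Xi^-\{\gamma\rhd\mathbf x\cdot\sigma(\Phi);\Delta\}\to\Xi^-\{\gamma\rhd\mathbf x,\mathbf y\cdot\Phi;\Delta\}$. In ipis/apis $\sigma:\mathbf y$ is capture-avoiding in $(\emptyset\cdot\Phi\rhd\Delta)$, in ipet/apet in $\Phi$. Natural steps are closed under all contexts ($\Phi\to\Psi$ an $\mathsf N$-instance gives $\Xi\{\Phi\}\to\Xi\{\Psi\}$). $\to^*$ is a finite sequence of steps. Semantics: a Kripke structure $(W,\le,(M_w)_{w\in W})$ has a preorder $\le$ on worlds and, for each $w$, a nonempty domain $M_w$ and relations $[\![p]\!]_w\subseteq M_w^{\mathrm{ar}(p)}$, with $M_w\subseteq M_{w'}$ and $[\![p]\!]_w\subseteq[\![p]\!]_{w'}$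 whenever $w\le w'$. A $w$-evaluation is $e:\mathcal V\to M_w$. Forcing: $w\Vdash_e p(x_1,\dots,x_n)$ iff $(e(x_1),\dots,e(x_n))\in[\![p]\!]_w$; $w\Vdash_e\Phi$ iff $w\Vdash_e\phi$ for all $\phi\in\Phi$; $w\Vdash_e(\mathbf x\cdot\Phi\rhd\mathbf x_1\cdot\Phi_1;\dots;\mathbf x_n\cdot\Phi_n)$ iff for every $w'\ge w$ and $w'$-evaluation $e'$ with $w'\Vdash_{e[\mathbf x\mapsto e']}\Phi$, there are $1\le i\le n$ and a $w'$-evaluation $e''$ with $w'\Vdash_{e[\mathbf x\mapsto e'][\mathbf x_i\mapsto e'']}\Phi_i$. $\Phi\models\Psi$ means that in every Kripke structure, for every world $w$ and $w$-evaluation $e$, $w\Vdash_e\Phi$ implies $w\Vdash_e\Psi$. *)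

theory Defs
  imports "HOL-Library.Multiset" "HOL-Library.FSet" "HOL-Library.Countable"
begin

text \<open>Intuitionistic flowers, gardens and bouquets. Variables are the elements of \<open>'v\<close>,
  predicate symbols the elements of \<open>'p\<close>.\<close>

datatype ('v, 'p) flower =
    Atom 'p "'v list"
  | Flower "('v, 'p) garden" "('v, 'p) garden multiset" (infix "\<rhd>" 60)
and ('v, 'p) garden =
    Garden "'v fset" "('v, 'p) flower multiset" (infix "\<cdot>" 61)

type_synonym ('v, 'p) bouquet = "('v, 'p) flower multiset"

lemma size_multiset_member: "a \<in># M \<Longrightarrow> f a < size_multiset f M"
  by (induction M) auto

lemma size_member_termination [termination_simp]:
  "\<phi> \<in># \<Phi> \<Longrightarrow> size \<phi> < Suc (k + size_multiset size \<Phi>)"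
  "\<phi> \<in># \<Phi> \<Longrightarrow> size \<phi> < Suc (size_multiset size \<Phi> + k)"
  "\<phi> \<in># \<Phi> \<Longrightarrow> size \<phi> < Suc (Suc (k + (l + size_multiset size \<Phi>)))"
  "y \<cdot> \<Psi> \<in># \<Delta> \<Longrightarrow> \<psi> \<in># \<Psi> \<Longrightarrow> size \<psi> < Suc (Suc (size_multiset size \<Delta> + k))"
  using size_multiset_member[of \<phi> \<Phi> size] size_multiset_member[of \<psi> \<Psi> size]
    size_multiset_member[of "y \<cdot> \<Psi>" \<Delta> size] by auto

declare image_mset_cong [fundef_cong]

text \<open>The datatype does not enforce arities; the following predicate does.\<close>

fun arity_ok :: "('p \<Rightarrow> nat) \<Rightarrow> ('v, 'p) flower \<Rightarrow> bool" where
  "arity_ok ar (Atom p xs) \<longleftrightarrow> length xs = ar p"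
| "arity_ok ar (x \<cdot> \<Phi> \<rhd> \<Delta>) \<longleftrightarrow>
     (\<forall>\<phi>\<in>set_mset \<Phi>. arity_ok ar \<phi>) \<and>
     (\<forall>\<delta>\<in>set_mset \<Delta>. case \<delta> of y \<cdot> \<Psi> \<Rightarrow> \<forall>\<psi>\<in>set_mset \<Psi>. arity_ok ar \<psi>)"


section \<open>Free and bound variables\<close>

fun fv_flower :: "('v, 'p) flower \<Rightarrow> 'v set" where
  "fv_flower (Atom p xs) = set xs"
| "fv_flower (x \<cdot> \<Phi> \<rhd> \<Delta>) =
     ((\<Union>\<phi>\<in>set_mset \<Phi>. fv_flower \<phi>) - fset x) \<union>
     (\<Union>\<delta>\<in>set_mset \<Delta>. case \<delta> of y \<cdot> \<Psi> \<Rightarrow>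
        (\<Union>\<psi>\<in>set_mset \<Psi>. fv_flower \<psi>) - fset (x |\<union>| y))"

definition fv :: "('v, 'p) bouquet \<Rightarrow> 'v set" where
  "fv \<Phi> = (\<Union>\<phi>\<in>set_mset \<Phi>. fv_flower \<phi>)"

fun fv_garden :: "('v, 'p) garden \<Rightarrow> 'v set" where
  "fv_garden (x \<cdot> \<Phi>) = fv \<Phi> - fset x"

lemma fv_flower_garden:
  "fv_flower (x \<cdot> \<Phi> \<rhd> \<Delta>) =
     fv_garden (x \<cdot> \<Phi>) \<union> (\<Union>\<delta>\<in>set_mset \<Delta>. case \<delta> of y \<cdot> \<Psi> \<Rightarrow> fv_garden ((x |\<union>| y) \<cdot> \<Psi>))"
  by (auto simp: fv_def split: garden.splits)

fun bv_flower :: "('v, 'p) flower \<Rightarrow> 'v set"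
  and bv_garden :: "('v, 'p) garden \<Rightarrow> 'v set" where
  "bv_flower (Atom p xs) = {}"
| "bv_flower (\<gamma> \<rhd> \<Delta>) = bv_garden \<gamma> \<union> (\<Union>\<delta>\<in>set_mset \<Delta>. bv_garden \<delta>)"
| "bv_garden (x \<cdot> \<Phi>) = fset x \<union> (\<Union>\<phi>\<in>set_mset \<Phi>. bv_flower \<phi>)"

definition bv :: "('v, 'p) bouquet \<Rightarrow> 'v set" where
  "bv \<Phi> = (\<Union>\<phi>\<in>set_mset \<Phi>. bv_flower \<phi>)"

text \<open>The multiset of all binding occurrences of variables.\<close>

fun binders_flower :: "('v, 'p) flower \<Rightarrow> 'v multiset"
  and binders_garden :: "('v, 'p) garden \<Rightarrow> 'v multiset" where
  "binders_flower (Atom p xs) = {#}"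
| "binders_flower (\<gamma> \<rhd> \<Delta>) = binders_garden \<gamma> + (\<Sum>\<^sub># (image_mset binders_garden \<Delta>))"
| "binders_garden (x \<cdot> \<Phi>) = mset_set (fset x) + (\<Sum>\<^sub># (image_mset binders_flower \<Phi>))"

definition binders :: "('v, 'p) bouquet \<Rightarrow> 'v multiset" where
  "binders \<Phi> = \<Sum>\<^sub># (image_mset binders_flower \<Phi>)"

text \<open>The standing variable convention: binders are pairwise distinct, and no variable is both
  bound and free.\<close>

definition var_convention :: "('v, 'p) bouquet \<Rightarrow> bool" where
  "var_convention \<Phi> \<longleftrightarrow> (\<forall>v. count (binders \<Phi>) v \<le> 1) \<and> bv \<Phi> \<inter> fv \<Phi> = {}"

text \<open>Several rules copy subterms, so a literal rule instance may have repeated binders on one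
  side, to be renamed apart afterwards. What a literal instance must satisfy is
  the part of the convention that prevents variable capture: no variable is bound again inside
  its own scope (the scope of a pistil's sprinkler includes the petals), and no variable is both
  bound and free.\<close>

fun no_rebind_flower :: "('v, 'p) flower \<Rightarrow> bool"
  and no_rebind_garden :: "('v, 'p) garden \<Rightarrow> bool" where
  "no_rebind_flower (Atom p xs) \<longleftrightarrow> True"
| "no_rebind_flower (\<gamma> \<rhd> \<Delta>) \<longleftrightarrow>
     no_rebind_garden \<gamma> \<and>
     (\<forall>\<delta>\<in>set_mset \<Delta>. no_rebind_garden \<delta> \<and> (case \<gamma> of x \<cdot> \<Phi> \<Rightarrow> fset x \<inter> bv_garden \<delta> = {}))"
| "no_rebind_garden (x \<cdot> \<Phi>) \<longleftrightarrow>
     fset x \<inter> bv \<Phi> = {} \<and> (\<forall>\<phi>\<in>set_mset \<Phi>. no_rebind_flower \<phi>)"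

definition capture_free :: "('v, 'p) bouquet \<Rightarrow> bool" where
  "capture_free \<Phi> \<longleftrightarrow> (\<forall>\<phi>\<in>set_mset \<Phi>. no_rebind_flower \<phi>) \<and> bv \<Phi> \<inter> fv \<Phi> = {}"

lemma set_binders:
  fixes \<phi> :: "('v, 'p) flower" and \<gamma> :: "('v, 'p) garden"
  shows
  "set_mset (binders_flower \<phi>) = bv_flower \<phi>"
  "set_mset (binders_garden \<gamma>) = bv_garden \<gamma>"
  by (induction \<phi> and \<gamma>) auto

lemma count_le_1_add:
  assumes "\<forall>v. count (A + B) v \<le> 1"
  shows "\<forall>v. count A v \<le> 1" "\<forall>v. count B v \<le> 1" "set_mset A \<inter> set_mset B = {}"
proof -
  have *: "count A v + count B v \<le> 1" for v
    using assms by simp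
  show "\<forall>v. count A v \<le> 1" "\<forall>v. count B v \<le> 1"
    using * by (meson add_leD1 add_leD2)+
  have "False" if "v \<in># A" "v \<in># B" for v
    using *[of v] that by (simp flip: count_greater_zero_iff)
  then show "set_mset A \<inter> set_mset B = {}"
    by blast
qed

lemma count_le_1_sum:
  assumes "\<forall>v. count (\<Sum>\<^sub># (image_mset f M)) v \<le> 1" "a \<in># M"
  shows "\<forall>v. count (f a) v \<le> 1"
proof -
  obtain N where "M = add_mset a N"
    using assms(2) by (metis insert_DiffM)
  then have "\<forall>v. count (f a + \<Sum>\<^sub># (image_mset f N)) v \<le> 1"
    using assms(1) by simp
  then show ?thesis
    by (rule count_le_1_add(1))
qed

lemma distinct_binders_no_rebind:
  fixes \<phi> :: "('v, 'p) flower" and \<gamma> :: "('v, 'p) garden"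
  shows
  "\<forall>v. count (binders_flower \<phi>) v \<le> 1 \<Longrightarrow> no_rebind_flower \<phi>"
  "\<forall>v. count (binders_garden \<gamma>) v \<le> 1 \<Longrightarrow> no_rebind_garden \<gamma>"
proof (induction \<phi> and \<gamma>)
  case (Flower \<gamma> \<Delta>)
  note c = count_le_1_add[OF Flower.prems[unfolded binders_flower.simps]]
  have "no_rebind_garden \<delta>" if "\<delta> \<in># \<Delta>" for \<delta>
    by (rule Flower.IH(2)[OF that count_le_1_sum[OF c(2) that]])
  moreover have "bv_garden \<gamma> \<inter> bv_garden \<delta> = {}" if "\<delta> \<in># \<Delta>" for \<delta>
    using c(3) that by (auto simp: set_binders)
  ultimately show ?case
    using Flower.IH(1)[OF c(1)] by (cases \<gamma>) auto
next
  case (Garden x \<Phi>)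
  note c = count_le_1_add[OF Garden.prems[unfolded binders_garden.simps]]
  have "no_rebind_flower \<phi>" if "\<phi> \<in># \<Phi>" for \<phi>
    by (rule Garden.IH[OF that count_le_1_sum[OF c(2) that]])
  moreover have "fset x \<inter> bv \<Phi> = {}"
    using c(3) by (auto simp: set_binders bv_def)
  ultimately show ?case
    by simp
qed simp

lemma var_convention_capture_free:
  assumes "var_convention \<Phi>"
  shows "capture_free \<Phi>"
proof -
  have c: "\<forall>v. count (\<Sum>\<^sub># (image_mset binders_flower \<Phi>)) v \<le> 1" and "bv \<Phi> \<inter> fv \<Phi> = {}"
    using assms by (simp_all add: var_convention_def binders_def)
  moreover have "no_rebind_flower \<phi>" if "\<phi> \<in># \<Phi>" for \<phi>
    by (rule distinct_binders_no_rebind(1)[OF count_le_1_sum[OF c that]])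
  ultimately show ?thesis
    by (simp add: capture_free_def)
qed


section \<open>Substitutions\<close>

text \<open>\<open>override_on f g R\<close> is the function $f[R \mapsto g]$.\<close>

definition subst_on :: "('v \<Rightarrow> 'v) \<Rightarrow> 'v fset \<Rightarrow> bool" where
  "subst_on \<sigma> y \<longleftrightarrow> {v. \<sigma> v \<noteq> v} = fset y"

fun subst_flower :: "('v \<Rightarrow> 'v) \<Rightarrow> ('v, 'p) flower \<Rightarrow> ('v, 'p) flower"
  and subst_garden :: "('v \<Rightarrow> 'v) \<Rightarrow> ('v, 'p) garden \<Rightarrow> ('v, 'p) garden" where
  "subst_flower \<sigma> (Atom p xs) = Atom p (map \<sigma> xs)"
| "subst_flower \<sigma> (x \<cdot> \<Phi> \<rhd> \<Delta>) =
     subst_garden \<sigma> (x \<cdot> \<Phi>) \<rhd> image_mset (subst_garden (override_on \<sigma> id (fset x))) \<Delta>"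
| "subst_garden \<sigma> (x \<cdot> \<Phi>) = x \<cdot> image_mset (subst_flower (override_on \<sigma> id (fset x))) \<Phi>"

abbreviation subst :: "('v \<Rightarrow> 'v) \<Rightarrow> ('v, 'p) bouquet \<Rightarrow> ('v, 'p) bouquet" where
  "subst \<sigma> \<equiv> image_mset (subst_flower \<sigma>)"

abbreviation subst_corolla ::
    "('v \<Rightarrow> 'v) \<Rightarrow> ('v, 'p) garden multiset \<Rightarrow> ('v, 'p) garden multiset" where
  "subst_corolla \<sigma> \<equiv> image_mset (subst_garden \<sigma>)"

definition capture_avoiding :: "('v \<Rightarrow> 'v) \<Rightarrow> 'v fset \<Rightarrow> ('v, 'p) bouquet \<Rightarrow> bool" where
  "capture_avoiding \<sigma> y \<Phi> \<longleftrightarrow> \<sigma> ` fset y \<inter> bv \<Phi> = {}"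


section \<open>Contexts\<close>

datatype ('v, 'p) ctx = Ctx "('v, 'p) bouquet" "('v, 'p) fctx"
and ('v, 'p) fctx =
    Hole
  | In_Pistil "'v fset" "('v, 'p) ctx" "('v, 'p) garden multiset"
  | In_Petal "('v, 'p) garden" "'v fset" "('v, 'p) ctx" "('v, 'p) garden multiset"

primrec fill :: "('v, 'p) ctx \<Rightarrow> ('v, 'p) bouquet \<Rightarrow> ('v, 'p) bouquet"
  and fill_f :: "('v, 'p) fctx \<Rightarrow> ('v, 'p) bouquet \<Rightarrow> ('v, 'p) bouquet" where
  "fill (Ctx \<Psi> \<xi>) \<Theta> = \<Psi> + fill_f \<xi> \<Theta>"
| "fill_f Hole \<Theta> = \<Theta>"
| "fill_f (In_Pistil x \<Xi> \<Delta>) \<Theta> = {# x \<cdot> fill \<Xi> \<Theta> \<rhd> \<Delta> #}"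
| "fill_f (In_Petal \<gamma> x \<Xi> \<Delta>) \<Theta> = {# \<gamma> \<rhd> add_mset (x \<cdot> fill \<Xi> \<Theta>) \<Delta> #}"

primrec juxtapose :: "('v, 'p) bouquet \<Rightarrow> ('v, 'p) ctx \<Rightarrow> ('v, 'p) ctx" where
  "juxtapose \<Psi> (Ctx \<Psi>' \<xi>) = Ctx (\<Psi> + \<Psi>') \<xi>"

text \<open>Filling the hole of a context with another context.\<close>

primrec fill_ctx :: "('v, 'p) ctx \<Rightarrow> ('v, 'p) ctx \<Rightarrow> ('v, 'p) ctx"
  and fill_ctx_f :: "('v, 'p) fctx \<Rightarrow> ('v, 'p) ctx \<Rightarrow> ('v, 'p) ctx" where
  "fill_ctx (Ctx \<Psi> \<xi>) \<Xi>\<^sub>0 = juxtapose \<Psi> (fill_ctx_f \<xi> \<Xi>\<^sub>0)"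
| "fill_ctx_f Hole \<Xi>\<^sub>0 = \<Xi>\<^sub>0"
| "fill_ctx_f (In_Pistil x \<Xi> \<Delta>) \<Xi>\<^sub>0 = Ctx {#} (In_Pistil x (fill_ctx \<Xi> \<Xi>\<^sub>0) \<Delta>)"
| "fill_ctx_f (In_Petal \<gamma> x \<Xi> \<Delta>) \<Xi>\<^sub>0 = Ctx {#} (In_Petal \<gamma> x (fill_ctx \<Xi> \<Xi>\<^sub>0) \<Delta>)"

lemma fill_juxtapose: "fill (juxtapose \<Psi> \<Xi>) \<Theta> = \<Psi> + fill \<Xi> \<Theta>"
  by (cases \<Xi>) (simp add: add.assoc)

lemma fill_fill_ctx:
  "fill (fill_ctx \<Xi> \<Xi>\<^sub>0) \<Theta> = fill \<Xi> (fill \<Xi>\<^sub>0 \<Theta>)"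
  "fill (fill_ctx_f \<xi> \<Xi>\<^sub>0) \<Theta> = fill_f \<xi> (fill \<Xi>\<^sub>0 \<Theta>)"
  by (induction \<Xi> and \<xi>) (simp_all add: fill_juxtapose)

primrec inversions :: "('v, 'p) ctx \<Rightarrow> nat"
  and inversions_f :: "('v, 'p) fctx \<Rightarrow> nat" where
  "inversions (Ctx \<Psi> \<xi>) = inversions_f \<xi>"
| "inversions_f Hole = 0"
| "inversions_f (In_Pistil x \<Xi> \<Delta>) = 1 + inversions \<Xi>"
| "inversions_f (In_Petal \<gamma> x \<Xi> \<Delta>) = inversions \<Xi>"

abbreviation positive :: "('v, 'p) ctx \<Rightarrow> bool" where
  "positive \<Xi> \<equiv> even (inversions \<Xi>)"

abbreviation negative :: "('v, 'p) ctx \<Rightarrow> bool" where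
  "negative \<Xi> \<equiv> odd (inversions \<Xi>)"

definition pollinable_flower :: "('v, 'p) flower \<Rightarrow> ('v, 'p) ctx \<Rightarrow> bool" where
  "pollinable_flower \<phi> \<Xi> \<longleftrightarrow>
     (\<exists>\<Psi> \<Xi>' \<Xi>\<^sub>0. \<phi> \<in># \<Psi> \<and>
        (\<Xi> = fill_ctx \<Xi>' (juxtapose \<Psi> \<Xi>\<^sub>0) \<or>
         (\<exists>x y \<Delta>. \<Xi> = fill_ctx \<Xi>' (Ctx {#} (In_Petal (x \<cdot> \<Psi>) y \<Xi>\<^sub>0 \<Delta>)))))"

definition pollinable :: "('v, 'p) bouquet \<Rightarrow> ('v, 'p) ctx \<Rightarrow> bool" where
  "pollinable \<Phi> \<Xi> \<longleftrightarrow> (\<forall>\<phi>\<in>set_mset \<Phi>. pollinable_flower \<phi> \<Xi>)"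


section \<open>Rules\<close>

text \<open>In \<open>R \<Phi> \<Psi>\<close> the first argument is the conclusion, the second the premiss.\<close>

inductive natural :: "('v, 'p) bouquet \<Rightarrow> ('v, 'p) bouquet \<Rightarrow> bool" where
  poll_down: "pollinable \<Phi> \<Xi> \<Longrightarrow> natural (fill \<Xi> \<Phi>) (fill \<Xi> {#})"
| poll_up: "pollinable \<Phi> \<Xi> \<Longrightarrow> natural (fill \<Xi> {#}) (fill \<Xi> \<Phi>)"
| epis: "natural \<Phi> {# {||} \<cdot> {#} \<rhd> {# {||} \<cdot> \<Phi> #} #}"
| epet: "natural {# \<gamma> \<rhd> add_mset ({||} \<cdot> {#}) \<Delta> #} {#}"
| srep: "natural {# x \<cdot> (\<Phi> + {# {||} \<cdot> {#} \<rhd> \<Gamma> #}) \<rhd> \<Delta> #}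
                 {# x \<cdot> \<Phi> \<rhd> {# {||} \<cdot> {# \<gamma> \<rhd> \<Delta>. \<gamma> \<in># \<Gamma> #} #} #}"
| ipis: "subst_on \<sigma> y \<Longrightarrow> capture_avoiding \<sigma> y {# {||} \<cdot> \<Phi> \<rhd> \<Delta> #} \<Longrightarrow>
         natural {# (x |\<union>| y) \<cdot> \<Phi> \<rhd> \<Delta> #}
                 {# x \<cdot> subst \<sigma> \<Phi> \<rhd> subst_corolla \<sigma> \<Delta>, (x |\<union>| y) \<cdot> \<Phi> \<rhd> \<Delta> #}"
| ipet: "subst_on \<sigma> y \<Longrightarrow> capture_avoiding \<sigma> y \<Phi> \<Longrightarrow>
         natural {# \<gamma> \<rhd> {# (x |\<union>| y) \<cdot> \<Phi> #} + \<Delta> #}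
                 {# \<gamma> \<rhd> {# x \<cdot> subst \<sigma> \<Phi>, (x |\<union>| y) \<cdot> \<Phi> #} + \<Delta> #}"

inductive cultural :: "('v, 'p) bouquet \<Rightarrow> ('v, 'p) bouquet \<Rightarrow> bool" where
  grow: "positive \<Xi> \<Longrightarrow> cultural (fill \<Xi> {#}) (fill \<Xi> \<Phi>)"
| crop: "negative \<Xi> \<Longrightarrow> cultural (fill \<Xi> \<Phi>) (fill \<Xi> {#})"
| pull: "positive \<Xi> \<Longrightarrow> cultural (fill \<Xi> {# \<gamma> \<rhd> \<Gamma> + \<Delta> #}) (fill \<Xi> {# \<gamma> \<rhd> \<Delta> #})"
| glue: "negative \<Xi> \<Longrightarrow> cultural (fill \<Xi> {# \<gamma> \<rhd> \<Delta> #}) (fill \<Xi> {# \<gamma> \<rhd> \<Gamma> + \<Delta> #})"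
| apis: "positive \<Xi> \<Longrightarrow> subst_on \<sigma> y \<Longrightarrow> capture_avoiding \<sigma> y {# {||} \<cdot> \<Phi> \<rhd> \<Delta> #} \<Longrightarrow>
         cultural (fill \<Xi> {# x \<cdot> subst \<sigma> \<Phi> \<rhd> subst_corolla \<sigma> \<Delta> #})
                  (fill \<Xi> {# (x |\<union>| y) \<cdot> \<Phi> \<rhd> \<Delta> #})"
| apet: "negative \<Xi> \<Longrightarrow> subst_on \<sigma> y \<Longrightarrow> capture_avoiding \<sigma> y \<Phi> \<Longrightarrow>
         cultural (fill \<Xi> {# \<gamma> \<rhd> {# x \<cdot> subst \<sigma> \<Phi> #} + \<Delta> #})
                  (fill \<Xi> {# \<gamma> \<rhd> {# (x |\<union>| y) \<cdot> \<Phi> #} + \<Delta> #})"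

inductive rule_step :: "('v, 'p) bouquet \<Rightarrow> ('v, 'p) bouquet \<Rightarrow> bool" where
  natural_step: "natural \<Phi> \<Psi> \<Longrightarrow> rule_step (fill \<Xi> \<Phi>) (fill \<Xi> \<Psi>)"
| cultural_step: "cultural \<Phi> \<Psi> \<Longrightarrow> rule_step \<Phi> \<Psi>"

text \<open>Renaming some of the variables \<open>y\<close> of one sprinkler injectively to fresh variables.\<close>

inductive rename :: "('v, 'p) bouquet \<Rightarrow> ('v, 'p) bouquet \<Rightarrow> bool" where
  rename_pistil: "subst_on \<sigma> y \<Longrightarrow> y |\<subseteq>| x \<Longrightarrow> inj_on \<sigma> (fset y) \<Longrightarrow>
     \<sigma> ` fset y \<inter> (fv_flower (x \<cdot> \<Phi> \<rhd> \<Delta>) \<union> bv_flower (x \<cdot> \<Phi> \<rhd> \<Delta>)) = {} \<Longrightarrow>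
     rename (fill \<Xi> {# x \<cdot> \<Phi> \<rhd> \<Delta> #})
            (fill \<Xi> {# (\<sigma> |`| x) \<cdot> subst \<sigma> \<Phi> \<rhd> subst_corolla \<sigma> \<Delta> #})"
| rename_petal: "subst_on \<sigma> y \<Longrightarrow> y |\<subseteq>| x \<Longrightarrow> inj_on \<sigma> (fset y) \<Longrightarrow>
     \<sigma> ` fset y \<inter> (fv_garden (x \<cdot> \<Phi>) \<union> bv_garden (x \<cdot> \<Phi>)) = {} \<Longrightarrow>
     rename (fill \<Xi> {# \<gamma> \<rhd> {# x \<cdot> \<Phi> #} + \<Delta> #})
            (fill \<Xi> {# \<gamma> \<rhd> {# (\<sigma> |`| x) \<cdot> subst \<sigma> \<Phi> #} + \<Delta> #})"

abbreviation alpha_equiv :: "('v, 'p) bouquet \<Rightarrow> ('v, 'p) bouquet \<Rightarrow> bool" where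
  "alpha_equiv \<equiv> equivclp rename"

definition admissible :: "('p \<Rightarrow> nat) \<Rightarrow> ('v, 'p) bouquet \<Rightarrow> bool" where
  "admissible ar \<Phi> \<longleftrightarrow> (\<forall>\<phi>\<in>set_mset \<Phi>. arity_ok ar \<phi>) \<and> var_convention \<Phi>"

text \<open>Steps relate bouquets obeying the variable convention. As usual with such a convention,
  bound variables may be renamed before and after applying a rule; without this, e.g. \<open>ipis\<close>
  with nonempty \<open>x\<close> would never apply.\<close>

definition step :: "('p \<Rightarrow> nat) \<Rightarrow> ('v, 'p) bouquet \<Rightarrow> ('v, 'p) bouquet \<Rightarrow> bool" where
  "step ar \<Phi> \<Psi> \<longleftrightarrow> admissible ar \<Phi> \<and> admissible ar \<Psi> \<and>
     (\<exists>\<Phi>' \<Psi>'. alpha_equiv \<Phi> \<Phi>' \<and> capture_free \<Phi>' \<and> rule_step \<Phi>' \<Psi>' \<and>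
        capture_free \<Psi>' \<and> alpha_equiv \<Psi>' \<Psi>)"

lemma rule_step_imp_step:
  "admissible ar \<Phi> \<Longrightarrow> admissible ar \<Psi> \<Longrightarrow> rule_step \<Phi> \<Psi> \<Longrightarrow> step ar \<Phi> \<Psi>"
  unfolding step_def
  by (metis admissible_def equivclp_refl var_convention_capture_free)

abbreviation steps :: "('p \<Rightarrow> nat) \<Rightarrow> ('v, 'p) bouquet \<Rightarrow> ('v, 'p) bouquet \<Rightarrow> bool" where
  "steps ar \<equiv> (step ar)\<^sup>*\<^sup>*"


section \<open>Kripke semantics\<close>

record ('w, 'm, 'p) kripke =
  worlds :: "'w set"
  world_le :: "'w \<Rightarrow> 'w \<Rightarrow> bool"
  domain :: "'w \<Rightarrow> 'm set"
  interp :: "'w \<Rightarrow> 'p \<Rightarrow> 'm list set"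

definition kripke_structure :: "('p \<Rightarrow> nat) \<Rightarrow> ('w, 'm, 'p) kripke \<Rightarrow> bool" where
  "kripke_structure ar K \<longleftrightarrow>
     reflp_on (worlds K) (world_le K) \<and> transp_on (worlds K) (world_le K) \<and>
     (\<forall>w\<in>worlds K. domain K w \<noteq> {} \<and>
        (\<forall>p. interp K w p \<subseteq> {ms. length ms = ar p \<and> set ms \<subseteq> domain K w})) \<and>
     (\<forall>w\<in>worlds K. \<forall>w'\<in>worlds K. world_le K w w' \<longrightarrow>
        domain K w \<subseteq> domain K w' \<and> (\<forall>p. interp K w p \<subseteq> interp K w' p))"

definition evaluation :: "('w, 'm, 'p) kripke \<Rightarrow> 'w \<Rightarrow> ('v \<Rightarrow> 'm) \<Rightarrow> bool" where
  "evaluation K w e \<longleftrightarrow> range e \<subseteq> domain K w"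

fun forces_flower :: "('w, 'm, 'p) kripke \<Rightarrow> 'w \<Rightarrow> ('v \<Rightarrow> 'm) \<Rightarrow> ('v, 'p) flower \<Rightarrow> bool" where
  "forces_flower K w e (Atom p xs) \<longleftrightarrow> map e xs \<in> interp K w p"
| "forces_flower K w e (x \<cdot> \<Phi> \<rhd> \<Delta>) \<longleftrightarrow>
     (\<forall>w'\<in>worlds K. \<forall>e'. world_le K w w' \<and> evaluation K w' e' \<and>
        (\<forall>\<phi>\<in>set_mset \<Phi>. forces_flower K w' (override_on e e' (fset x)) \<phi>) \<longrightarrow>
        (\<exists>\<delta>\<in>set_mset \<Delta>. case \<delta> of y \<cdot> \<Psi> \<Rightarrow>
           \<exists>e''. evaluation K w' e'' \<and>
             (\<forall>\<psi>\<in>set_mset \<Psi>.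
                forces_flower K w' (override_on (override_on e e' (fset x)) e'' (fset y)) \<psi>)))"

definition forces :: "('w, 'm, 'p) kripke \<Rightarrow> 'w \<Rightarrow> ('v \<Rightarrow> 'm) \<Rightarrow> ('v, 'p) bouquet \<Rightarrow> bool" where
  "forces K w e \<Phi> \<longleftrightarrow> (\<forall>\<phi>\<in>set_mset \<Phi>. forces_flower K w e \<phi>)"

text \<open>Entailment over all Kripke structures whose worlds and individuals are drawn from the types
  \<open>'w\<close> and \<open>'m\<close>; HOL cannot quantify over types inside a formula, so the types
  are parameters, and a theorem that leaves them free speaks about all Kripke structures.\<close>

definition entails ::
    "'w itself \<Rightarrow> 'm itself \<Rightarrow> ('p \<Rightarrow> nat) \<Rightarrow> ('v, 'p) bouquet \<Rightarrow> ('v, 'p) bouquet \<Rightarrow> bool" where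
  "entails _ _ ar \<Phi> \<Psi> \<longleftrightarrow>
     (\<forall>(K :: ('w, 'm, 'p) kripke) w e. kripke_structure ar K \<longrightarrow> w \<in> worlds K \<longrightarrow>
        evaluation K w e \<longrightarrow> forces K w e \<Phi> \<longrightarrow> forces K w e \<Psi>)"

end

theory Submission
  imports Defs
begin

text \<open>
  Forcing is persistent, depends only on the free variables, and commutes with capture-avoiding
  substitution; hence the local rules and renamings are sound, and a context transports an
  entailment forwards or backwards according to the parity of its inversions. Transport only needs
  the entailment at accessible worlds and for evaluations that change the variables bound in the
  context. This is what makes pollination sound: a pollinating flower stays forced all the way down
  to the hole, because capture freeness keeps its free variables away from the binders on the path.
\<close>

section \<open>Structural lemmas\<close>

text \<open>Natural rules apply in contexts of either parity, so an entailment from premiss to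
  conclusion is not enough for them: each has to be an equivalence. Cultural rules fix the parity of
  their context, and one entailment at the hole suffices. The reversal at pistils comes from reading
  a flower as a universally quantified implication whose antecedent is the conjunction in the pistil
  and whose succedent is the disjunction of the existentially quantified petals. Variable capture is
  the obstacle. Pollination carries a flower across sprinklers, and \<open>srep\<close> puts a
  corolla below sprinklers that did not bind in it before. Both can fail if a variable is captured,
  and these are the rules where capture freeness of the conclusion is used; instantiation and
  renaming rely on their own side conditions. Capture freeness is given for the whole bouquet and
  has to be pushed down to the redex. Opening a sprinkler frees its variables, and the ban on
  rebinding keeps them disjoint from the binders further inside.\<close>

lemma flower_induct [case_names Atom Flower]:
  assumes atom: "\<And>p xs. P (Atom p xs)"
    and flower: "\<And>x \<Phi> \<Delta>. (\<And>\<phi>. \<phi> \<in># \<Phi> \<Longrightarrow> P \<phi>) \<Longrightarrow>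
      (\<And>y \<Psi> \<psi>. y \<cdot> \<Psi> \<in># \<Delta> \<Longrightarrow> \<psi> \<in># \<Psi> \<Longrightarrow> P \<psi>) \<Longrightarrow> P (x \<cdot> \<Phi> \<rhd> \<Delta>)"
  shows "P \<phi>"
proof -
  \<comment> \<open>The mutual induction needs a predicate on gardens; asking \<open>P\<close> of
    every flower of the garden turns its hypotheses into those of \<open>flower\<close>.\<close>
  have "P \<phi>" and "\<forall>x \<Phi>. \<gamma> = x \<cdot> \<Phi> \<longrightarrow> (\<forall>\<phi>\<in>set_mset \<Phi>. P \<phi>)" for \<gamma>
  proof (induction \<phi> and \<gamma>)
    case (Flower \<gamma> \<Delta>)
    then show ?case
      by (cases \<gamma>) (auto intro!: flower)
  qed (auto intro: atom)
  then show "P \<phi>" by blast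
qed

declare fv_flower.simps(2) [simp del] forces_flower.simps(2) [simp del]

lemma fv_union [simp]: "fv (\<Phi> + \<Psi>) = fv \<Phi> \<union> fv \<Psi>"
  by (auto simp: fv_def)

lemma bv_union [simp]: "bv (\<Phi> + \<Psi>) = bv \<Phi> \<union> bv \<Psi>"
  by (auto simp: bv_def)

lemma fv_single [simp]: "fv {#\<phi>#} = fv_flower \<phi>"
  by (auto simp: fv_def)

lemma bv_single [simp]: "bv {#\<phi>#} = bv_flower \<phi>"
  by (auto simp: bv_def)

lemma bv_garden_bv: "bv_garden (x \<cdot> \<Phi>) = fset x \<union> bv \<Phi>"
  by (simp add: bv_def)

lemma fv_pistil_subset: "fv \<Phi> \<subseteq> fv_flower (x \<cdot> \<Phi> \<rhd> \<Delta>) \<union> fset x"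
  by (auto simp: fv_flower_garden)

text \<open>The sprinkler of the pistil binds in the petals as well, so a variable free in a petal
  is lost only by belonging to \<open>x\<close>.\<close>

lemma fv_petal_subset:
  assumes "\<delta> \<in># \<Delta>"
  shows "fv_garden \<delta> \<subseteq> fv_flower (x \<cdot> \<Phi> \<rhd> \<Delta>) \<union> fset x"
proof (cases \<delta>)
  case (Garden y \<Psi>)
  then show ?thesis
    using assms unfolding fv_flower_garden by force
qed

lemma capture_free_union:
  "capture_free (\<Phi> + \<Psi>) \<Longrightarrow> capture_free \<Psi> \<and> bv \<Psi> \<inter> fv \<Phi> = {}"
  by (auto simp: capture_free_def)

text \<open>The variables of \<open>x\<close> may become free once the sprinkler is removed, but
  none of them is bound again inside, so free and bound variables stay disjoint.\<close>

lemma capture_free_pistil: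
  assumes "capture_free {# x \<cdot> \<Phi> \<rhd> \<Delta> #}"
  shows "capture_free \<Phi>"
  using assms fv_pistil_subset[of \<Phi> x \<Delta>]
  by (auto simp: capture_free_def bv_garden_bv simp del: bv_garden.simps)

text \<open>The second claim lets flowers of the pistil pollinate the petal. A variable free in
  \<open>\<Psi>\<close> is free in the whole flower or lies in \<open>x\<close>; binders of the
  petal avoid the former by disjointness of free and bound variables and the latter by the ban on
  rebinding.\<close>

lemma capture_free_petal:
  assumes "capture_free {# x \<cdot> \<Psi> \<rhd> add_mset (y \<cdot> \<Phi>) \<Delta> #}"
  shows "capture_free \<Phi>" and "bv_garden (y \<cdot> \<Phi>) \<inter> fv \<Psi> = {}"
  using assms fv_petal_subset[of "y \<cdot> \<Phi>" "add_mset (y \<cdot> \<Phi>) \<Delta>" x \<Psi>]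
    fv_pistil_subset[of \<Psi> x "add_mset (y \<cdot> \<Phi>) \<Delta>"]
  by (auto simp: capture_free_def bv_garden_bv simp del: bv_garden.simps)

lemma capture_free_fill:
  "capture_free (fill \<Xi> \<Phi>) \<Longrightarrow> capture_free \<Phi>"
  "capture_free (fill_f \<xi> \<Phi>) \<Longrightarrow> capture_free \<Phi>"
proof (induction \<Xi> and \<xi>)
  case (In_Petal \<gamma> x \<Xi> \<Delta>)
  then show ?case
    by (cases \<gamma>) (auto dest: capture_free_petal)
qed (auto dest: capture_free_union capture_free_pistil)

text \<open>\<open>bv (fill \<Xi> {#})\<close> plays the role of the bound variables of the context
  itself; freshness known for some filling thus passes to the bare context.\<close>

lemma bv_fill_mono:
  "bv (fill \<Xi> {#}) \<subseteq> bv (fill \<Xi> \<Phi>)"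
  "bv (fill_f \<xi> {#}) \<subseteq> bv (fill_f \<xi> \<Phi>)"
  by (induction \<Xi> and \<xi>) (auto simp: bv_garden_bv bv_def[of "{#}"] simp del: bv_garden.simps)

section \<open>Forcing\<close>

locale kripke_model =
  fixes ar :: "'p \<Rightarrow> nat" and K :: "('w, 'm, 'p) kripke"
  assumes kripke: "kripke_structure ar K"
begin

abbreviation accessible :: "'w \<Rightarrow> 'w \<Rightarrow> bool" (infix "\<preceq>" 50) where
  "w \<preceq> w' \<equiv> w \<in> worlds K \<and> w' \<in> worlds K \<and> world_le K w w'"

lemma accessible_refl: "w \<in> worlds K \<Longrightarrow> w \<preceq> w"
  using kripke by (auto simp: kripke_structure_def reflp_on_def)

lemma accessible_trans: "w \<preceq> w' \<Longrightarrow> w' \<preceq> w'' \<Longrightarrow> w \<preceq> w''"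
  using kripke unfolding kripke_structure_def transp_on_def by blast

lemma evaluation_mono: "w \<preceq> w' \<Longrightarrow> evaluation K w e \<Longrightarrow> evaluation K w' e"
  using kripke unfolding kripke_structure_def evaluation_def by blast

lemma evaluation_override:
  "evaluation K w e \<Longrightarrow> evaluation K w e' \<Longrightarrow> evaluation K w (override_on e e' X)"
  by (auto simp: evaluation_def override_on_def)

lemma evaluation_comp: "evaluation K w e \<Longrightarrow> evaluation K w (e \<circ> f)"
  by (auto simp: evaluation_def)

text \<open>As a petal, a garden is an existential statement over its sprinkler. A corolla is the
  disjunction of its petals, so the clause for flowers becomes an implication from the pistil to
  \<open>forces_some\<close>.\<close>

fun forces_garden :: "'w \<Rightarrow> ('v \<Rightarrow> 'm) \<Rightarrow> ('v, 'p) garden \<Rightarrow> bool" where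
  "forces_garden w e (y \<cdot> \<Psi>) \<longleftrightarrow>
     (\<exists>e'. evaluation K w e' \<and> forces K w (override_on e e' (fset y)) \<Psi>)"

definition forces_some :: "'w \<Rightarrow> ('v \<Rightarrow> 'm) \<Rightarrow> ('v, 'p) garden multiset \<Rightarrow> bool" where
  "forces_some w e \<Delta> \<longleftrightarrow> (\<exists>\<delta>\<in>set_mset \<Delta>. forces_garden w e \<delta>)"

lemma forces_union [simp]: "forces K w e (\<Phi> + \<Psi>) \<longleftrightarrow> forces K w e \<Phi> \<and> forces K w e \<Psi>"
  by (auto simp: forces_def)

lemma forces_add_mset [simp]:
  "forces K w e (add_mset \<phi> \<Phi>) \<longleftrightarrow> forces_flower K w e \<phi> \<and> forces K w e \<Phi>"
  by (auto simp: forces_def)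

lemma forces_empty [simp]: "forces K w e {#}"
  by (auto simp: forces_def)

lemma forces_some_union [simp]:
  "forces_some w e (\<Gamma> + \<Delta>) \<longleftrightarrow> forces_some w e \<Gamma> \<or> forces_some w e \<Delta>"
  by (auto simp: forces_some_def)

lemma forces_some_add_mset [simp]:
  "forces_some w e (add_mset \<delta> \<Delta>) \<longleftrightarrow> forces_garden w e \<delta> \<or> forces_some w e \<Delta>"
  by (auto simp: forces_some_def)

lemma forces_some_empty [simp]: "\<not> forces_some w e {#}"
  by (auto simp: forces_some_def)

lemma forces_flower_garden:
  "forces_flower K w e (x \<cdot> \<Phi> \<rhd> \<Delta>) \<longleftrightarrow>
    (\<forall>w'\<in>worlds K. \<forall>e'. world_le K w w' \<longrightarrow> evaluation K w' e' \<longrightarrow>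
      forces K w' (override_on e e' (fset x)) \<Phi> \<longrightarrow>
      forces_some w' (override_on e e' (fset x)) \<Delta>)"
proof -
  have "(case \<delta> of y \<cdot> \<Psi> \<Rightarrow> \<exists>e''. evaluation K w' e'' \<and>
      (\<forall>\<psi>\<in>set_mset \<Psi>. forces_flower K w' (override_on e1 e'' (fset y)) \<psi>)) \<longleftrightarrow>
    forces_garden w' e1 \<delta>" for w' and e1 :: "'a \<Rightarrow> 'm" and \<delta>
    by (cases \<delta>) (simp add: forces_def)
  then show ?thesis
    unfolding forces_flower.simps(2) by (auto simp: forces_def forces_some_def)
qed

lemma forces_flower_override:
  assumes "w \<in> worlds K"
  shows "forces_flower K w e (x \<cdot> \<Phi> \<rhd> \<Delta>) \<longleftrightarrow>
    (\<forall>w' e'. w \<preceq> w' \<longrightarrow> evaluation K w' e' \<longrightarrow> forces K w' (override_on e e' (fset x)) \<Phi> \<longrightarrow>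
      forces_some w' (override_on e e' (fset x)) \<Delta>)"
  using assms by (auto simp: forces_flower_garden)

text \<open>Quantifying over variants of \<open>e\<close> avoids computing with nested overrides and
  allows a witness such as \<open>e' \<circ> \<sigma>\<close> to be supplied directly. Domains grow
  along the order, so \<open>e\<close> is still an evaluation at \<open>w'\<close> and overriding it
  there gives one again.\<close>

lemma forces_flower_variant:
  assumes w: "w \<in> worlds K" and e: "evaluation K w e"
  shows "forces_flower K w e (x \<cdot> \<Phi> \<rhd> \<Delta>) \<longleftrightarrow>
    (\<forall>w' e'. w \<preceq> w' \<longrightarrow> evaluation K w' e' \<longrightarrow> (\<forall>v. v \<notin> fset x \<longrightarrow> e' v = e v) \<longrightarrow>
      forces K w' e' \<Phi> \<longrightarrow> forces_some w' e' \<Delta>)" (is "?L \<longleftrightarrow> ?R")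
proof
  assume ?L
  show ?R
  proof (intro allI impI)
    fix w' e' assume *: "w \<preceq> w'" "evaluation K w' e'" "\<forall>v. v \<notin> fset x \<longrightarrow> e' v = e v"
      "forces K w' e' \<Phi>"
    then have "override_on e e' (fset x) = e'"
      by (auto simp: override_on_def)
    then show "forces_some w' e' \<Delta>"
      using \<open>?L\<close>[unfolded forces_flower_override[OF w], rule_format, OF *(1,2)] *(4) by simp
  qed
next
  assume ?R
  then show ?L
    unfolding forces_flower_override[OF w]
    using evaluation_override[OF evaluation_mono[OF _ e]] by simp
qed

text \<open>The pistil is an antecedent and the corolla a succedent: entailments are reversed in the
  former and preserved in the latter. This is what inversions count.\<close>

lemma forces_flower_mono:
  assumes f: "forces_flower K w e (x \<cdot> \<Phi> \<rhd> \<Delta>)"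
    and w: "w \<in> worlds K" and e: "evaluation K w e"
    and pistil: "\<And>w' e'. w \<preceq> w' \<Longrightarrow> evaluation K w' e' \<Longrightarrow> \<forall>v. v \<notin> fset x \<longrightarrow> e' v = e v \<Longrightarrow>
      forces K w' e' \<Phi>' \<Longrightarrow> forces K w' e' \<Phi>"
    and petals: "\<And>w' e'. w \<preceq> w' \<Longrightarrow> evaluation K w' e' \<Longrightarrow> \<forall>v. v \<notin> fset x \<longrightarrow> e' v = e v \<Longrightarrow>
      forces K w' e' \<Phi>' \<Longrightarrow> forces_some w' e' \<Delta> \<Longrightarrow> forces_some w' e' \<Delta>'"
  shows "forces_flower K w e (x \<cdot> \<Phi>' \<rhd> \<Delta>')"
  unfolding forces_flower_variant[OF w e]
proof (intro allI impI)
  fix w' e' assume *: "w \<preceq> w'" "evaluation K w' e'" "\<forall>v. v \<notin> fset x \<longrightarrow> e' v = e v" "forces K w' e' \<Phi>'"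
  then have "forces_some w' e' \<Delta>"
    using f[unfolded forces_flower_variant[OF w e]] pistil[OF *] by blast
  then show "forces_some w' e' \<Delta>'"
    by (rule petals[OF *])
qed

lemma forces_garden_variant:
  assumes "evaluation K w e"
  shows "forces_garden w e (y \<cdot> \<Psi>) \<longleftrightarrow>
    (\<exists>e'. evaluation K w e' \<and> (\<forall>v. v \<notin> fset y \<longrightarrow> e' v = e v) \<and> forces K w e' \<Psi>)" (is "?L \<longleftrightarrow> ?R")
proof
  assume ?L
  then obtain e' where "evaluation K w e'" "forces K w (override_on e e' (fset y)) \<Psi>"
    by auto
  then show ?R
    using evaluation_override[OF assms] by (intro exI[of _ "override_on e e' (fset y)"]) simp
next
  assume ?R
  then obtain e' where e': "evaluation K w e'" "\<forall>v. v \<notin> fset y \<longrightarrow> e' v = e v" "forces K w e' \<Psi>"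
    by blast
  then have "override_on e e' (fset y) = e'"
    by (auto simp: override_on_def)
  with e' show ?L
    by auto
qed

section \<open>Persistence and dependence on free variables\<close>

lemma forces_flower_persistent:
  assumes "forces_flower K w e \<phi>" "w \<preceq> w'"
  shows "forces_flower K w' e \<phi>"
\<comment> \<open>No induction: the clause for a flower already ranges over all later worlds, so
  transitivity settles it, and monotonicity of the interpretation settles atoms.\<close>
proof (cases \<phi>)
  case (Atom p xs)
  then show ?thesis
    using assms kripke unfolding kripke_structure_def by (simp del: forces_flower.simps(2)) blast
next
  case (Flower \<gamma> \<Delta>)
  obtain x \<Phi> where "\<gamma> = x \<cdot> \<Phi>"
    by (cases \<gamma>)
  then show ?thesis
    using assms accessible_trans[OF assms(2)] unfolding Flower by (auto simp: forces_flower_override)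
qed

lemma forces_persistent: "forces K w e \<Phi> \<Longrightarrow> w \<preceq> w' \<Longrightarrow> forces K w' e \<Phi>"
  using forces_flower_persistent unfolding forces_def by blast

text \<open>The overriding form of the flower clause fits here: the same values are written over
  both evaluations, which therefore still agree on the free variables below each sprinkler.\<close>

lemma forces_flower_cong_fv:
  assumes "\<And>v. v \<in> fv_flower \<phi> \<Longrightarrow> e v = e' v"
  shows "forces_flower K w e \<phi> \<longleftrightarrow> forces_flower K w e' \<phi>"
  using assms
proof (induction \<phi> arbitrary: w e e' rule: flower_induct)
  case (Atom p xs)
  then have "map e xs = map e' xs"
    by simp
  then show ?case
    by (simp only: forces_flower.simps)
next
  case (Flower x \<Phi> \<Delta>)
  have pistil: "forces_flower K w' (override_on e e1 (fset x)) \<phi> \<longleftrightarrow>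
      forces_flower K w' (override_on e' e1 (fset x)) \<phi>" if "\<phi> \<in># \<Phi>" for w' e1 \<phi>
    by (rule Flower.IH(1)[OF that]) (use that Flower.prems in \<open>auto simp: fv_flower.simps(2) override_on_def\<close>)
  have petal: "forces_flower K w' (override_on (override_on e e1 (fset x)) e2 (fset y)) \<psi> \<longleftrightarrow>
      forces_flower K w' (override_on (override_on e' e1 (fset x)) e2 (fset y)) \<psi>"
    if "y \<cdot> \<Psi> \<in># \<Delta>" "\<psi> \<in># \<Psi>" for w' e1 e2 y \<Psi> \<psi>
    by (rule Flower.IH(2)[OF that]) (use that Flower.prems in \<open>force simp: fv_flower.simps(2) override_on_def\<close>)
  have "forces_garden w' (override_on e e1 (fset x)) \<delta> \<longleftrightarrow>
      forces_garden w' (override_on e' e1 (fset x)) \<delta>" if "\<delta> \<in># \<Delta>" for \<delta> w' e1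
    using petal that by (cases \<delta>) (auto simp: forces_def)
  with pistil show ?case
    by (simp add: forces_flower_garden forces_def forces_some_def)
qed

lemma forces_cong_fv:
  assumes "\<And>v. v \<in> fv \<Phi> \<Longrightarrow> e v = e' v"
  shows "forces K w e \<Phi> \<longleftrightarrow> forces K w e' \<Phi>"
proof -
  have "forces_flower K w e \<phi> \<longleftrightarrow> forces_flower K w e' \<phi>" if "\<phi> \<in># \<Phi>" for \<phi>
    by (rule forces_flower_cong_fv) (use assms that in \<open>auto simp: fv_def\<close>)
  then show ?thesis
    by (auto simp: forces_def)
qed

lemma forces_garden_cong_fv:
  assumes "\<And>v. v \<in> fv_garden \<delta> \<Longrightarrow> e v = e' v"
  shows "forces_garden w e \<delta> \<longleftrightarrow> forces_garden w e' \<delta>"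
proof (cases \<delta>)
  case (Garden y \<Psi>)
  have "forces K w (override_on e e1 (fset y)) \<Psi> \<longleftrightarrow> forces K w (override_on e' e1 (fset y)) \<Psi>" for e1
    by (rule forces_cong_fv) (use assms Garden in \<open>auto simp: override_on_def\<close>)
  then show ?thesis
    by (simp add: Garden)
qed

lemma forces_some_cong_fv:
  assumes "\<And>\<delta> v. \<delta> \<in># \<Delta> \<Longrightarrow> v \<in> fv_garden \<delta> \<Longrightarrow> e v = e' v"
  shows "forces_some w e \<Delta> \<longleftrightarrow> forces_some w e' \<Delta>"
  unfolding forces_some_def by (intro bex_cong refl forces_garden_cong_fv) (use assms in auto)

section \<open>Forcing and substitution\<close>

lemma override_on_comp_subst:
  assumes "\<And>v. \<sigma> v \<noteq> v \<Longrightarrow> \<sigma> v \<notin> X"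
  shows "override_on e e' X \<circ> override_on \<sigma> id X = override_on (e \<circ> \<sigma>) e' X"
proof
  fix v
  show "(override_on e e' X \<circ> override_on \<sigma> id X) v = override_on (e \<circ> \<sigma>) e' X v"
    \<comment> \<open>On \<open>X\<close> the restricted substitution is the identity. Off
      \<open>X\<close> a moved variable lands off \<open>X\<close> by assumption, and an unmoved one
      is off \<open>X\<close> anyway, so the override is not seen.\<close>
    using assms[of v] by (cases "\<sigma> v = v") (auto simp: override_on_def)
qed

text \<open>Stating capture avoidance through the moved variables makes it hereditary: resetting
  \<open>\<sigma>\<close> on a sprinkler leaves fewer moved variables, with unchanged images, while
  subterms have fewer binders.\<close>

lemma forces_subst_flower:
  assumes "\<And>v. \<sigma> v \<noteq> v \<Longrightarrow> \<sigma> v \<notin> bv_flower \<phi>"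
  shows "forces_flower K w e (subst_flower \<sigma> \<phi>) \<longleftrightarrow> forces_flower K w (e \<circ> \<sigma>) \<phi>"
  using assms
proof (induction \<phi> arbitrary: w e \<sigma> rule: flower_induct)
  case (Atom p xs)
  show ?case
    by (simp add: comp_def)
next
  case (Flower x \<Phi> \<Delta>)
  let ?\<sigma> = "override_on \<sigma> id (fset x)"
  have avoid_x: "override_on e e1 (fset x) \<circ> ?\<sigma> = override_on (e \<circ> \<sigma>) e1 (fset x)" for e1
    by (rule override_on_comp_subst) (use Flower.prems in auto)
  have moved: "\<sigma> v \<noteq> v" "?\<sigma> v = \<sigma> v" if "?\<sigma> v \<noteq> v" for v
    using that by (auto simp: override_on_def split: if_splits)
  have pistil: "forces_flower K w' (override_on e e1 (fset x)) (subst_flower ?\<sigma> \<phi>) \<longleftrightarrow>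
      forces_flower K w' (override_on (e \<circ> \<sigma>) e1 (fset x)) \<phi>" if "\<phi> \<in># \<Phi>" for w' e1 \<phi>
    unfolding avoid_x[symmetric]
    by (rule Flower.IH(1)[OF that]) (use that Flower.prems moved in force)
  have petal: "forces_flower K w' (override_on (override_on e e1 (fset x)) e2 (fset y))
        (subst_flower (override_on ?\<sigma> id (fset y)) \<psi>) \<longleftrightarrow>
      forces_flower K w' (override_on (override_on (e \<circ> \<sigma>) e1 (fset x)) e2 (fset y)) \<psi>"
    if *: "y \<cdot> \<Psi> \<in># \<Delta>" "\<psi> \<in># \<Psi>" for w' e1 e2 y \<Psi> \<psi>
  proof -
    have avoid_y: "override_on (override_on e e1 (fset x)) e2 (fset y) \<circ> override_on ?\<sigma> id (fset y) =
        override_on (override_on e e1 (fset x) \<circ> ?\<sigma>) e2 (fset y)"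
      by (rule override_on_comp_subst) (use * Flower.prems moved in force)
    show ?thesis
      unfolding avoid_x[symmetric] avoid_y[symmetric]
    proof (rule Flower.IH(2)[OF *])
      fix v assume "override_on ?\<sigma> id (fset y) v \<noteq> v"
      then have "\<sigma> v \<noteq> v" "override_on ?\<sigma> id (fset y) v = \<sigma> v"
        by (auto simp: override_on_def split: if_splits)
      then show "override_on ?\<sigma> id (fset y) v \<notin> bv_flower \<psi>"
        using * Flower.prems by force
    qed
  qed
  have "forces_garden w' (override_on e e1 (fset x)) (subst_garden ?\<sigma> \<delta>) \<longleftrightarrow>
      forces_garden w' (override_on (e \<circ> \<sigma>) e1 (fset x)) \<delta>" if "\<delta> \<in># \<Delta>" for \<delta> w' e1
    using petal that by (cases \<delta>) (auto simp: forces_def)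
  with pistil show ?case
    by (simp add: forces_flower_garden forces_def forces_some_def comp_def)
qed

lemma forces_subst:
  assumes "\<And>v. \<sigma> v \<noteq> v \<Longrightarrow> \<sigma> v \<notin> bv \<Phi>"
  shows "forces K w e (subst \<sigma> \<Phi>) \<longleftrightarrow> forces K w (e \<circ> \<sigma>) \<Phi>"
proof -
  have "forces_flower K w e (subst_flower \<sigma> \<phi>) \<longleftrightarrow> forces_flower K w (e \<circ> \<sigma>) \<phi>"
    if "\<phi> \<in># \<Phi>" for \<phi>
    by (rule forces_subst_flower) (use that assms in \<open>auto simp: bv_def\<close>)
  then show ?thesis
    by (simp add: forces_def)
qed

lemma forces_garden_subst:
  assumes "\<And>v. \<sigma> v \<noteq> v \<Longrightarrow> \<sigma> v \<notin> bv_garden \<delta>"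
  shows "forces_garden w e (subst_garden \<sigma> \<delta>) \<longleftrightarrow> forces_garden w (e \<circ> \<sigma>) \<delta>"
proof (cases \<delta>)
  case (Garden y \<Psi>)
  let ?\<sigma> = "override_on \<sigma> id (fset y)"
  have "forces K w (override_on e e' (fset y)) (subst ?\<sigma> \<Psi>) \<longleftrightarrow>
      forces K w (override_on e e' (fset y) \<circ> ?\<sigma>) \<Psi>" for e'
  proof (rule forces_subst)
    fix v assume "?\<sigma> v \<noteq> v"
    then have "\<sigma> v \<noteq> v" "?\<sigma> v = \<sigma> v"
      by (auto simp: override_on_def split: if_splits)
    then show "?\<sigma> v \<notin> bv \<Psi>"
      using assms by (auto simp: Garden bv_def)
  qed
  moreover have "override_on e e' (fset y) \<circ> ?\<sigma> = override_on (e \<circ> \<sigma>) e' (fset y)" for e'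
    by (rule override_on_comp_subst) (use assms in \<open>auto simp: Garden\<close>)
  ultimately show ?thesis
    by (simp add: Garden)
qed

lemma forces_some_subst:
  assumes "\<And>v \<delta>. \<sigma> v \<noteq> v \<Longrightarrow> \<delta> \<in># \<Delta> \<Longrightarrow> \<sigma> v \<notin> bv_garden \<delta>"
  shows "forces_some w e (subst_corolla \<sigma> \<Delta>) \<longleftrightarrow> forces_some w (e \<circ> \<sigma>) \<Delta>"
proof -
  have "forces_garden w e (subst_garden \<sigma> \<delta>) \<longleftrightarrow> forces_garden w (e \<circ> \<sigma>) \<delta>" if "\<delta> \<in># \<Delta>" for \<delta>
    by (rule forces_garden_subst) (use that assms in auto)
  then show ?thesis
    by (simp add: forces_some_def)
qed

section \<open>Contexts\<close>

text \<open>\<open>w\<^sub>0\<close>, \<open>e\<^sub>0\<close> and \<open>X\<close> stay fixed while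
  \<open>w\<close> and \<open>e\<close> vary along the path to the hole, so the local hypothesis is
  the same at every depth. Both parities are treated together because entering a pistil exchanges
  them. With \<open>X = UNIV\<close> this gives ordinary entailment; with \<open>X\<close> the bound
  variables of the context it gives pollination.\<close>

lemma forces_fill_local:
  fixes e\<^sub>0 :: "'v \<Rightarrow> 'm"
  assumes local: "\<And>w' e'. w\<^sub>0 \<preceq> w' \<Longrightarrow> evaluation K w' e' \<Longrightarrow> (\<And>v. v \<notin> X \<Longrightarrow> e' v = e\<^sub>0 v) \<Longrightarrow>
      forces K w' e' A \<Longrightarrow> forces K w' e' B"
  shows "w\<^sub>0 \<preceq> w \<Longrightarrow> evaluation K w e \<Longrightarrow> (\<And>v. v \<notin> X \<Longrightarrow> e v = e\<^sub>0 v) \<Longrightarrow>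
      bv (fill \<Xi> {#}) \<subseteq> X \<Longrightarrow>
      (positive \<Xi> \<longrightarrow> forces K w e (fill \<Xi> A) \<longrightarrow> forces K w e (fill \<Xi> B)) \<and>
      (negative \<Xi> \<longrightarrow> forces K w e (fill \<Xi> B) \<longrightarrow> forces K w e (fill \<Xi> A))"
    and "w\<^sub>0 \<preceq> w \<Longrightarrow> evaluation K w e \<Longrightarrow> (\<And>v. v \<notin> X \<Longrightarrow> e v = e\<^sub>0 v) \<Longrightarrow>
      bv (fill_f \<xi> {#}) \<subseteq> X \<Longrightarrow>
      (even (inversions_f \<xi>) \<longrightarrow> forces K w e (fill_f \<xi> A) \<longrightarrow> forces K w e (fill_f \<xi> B)) \<and>
      (odd (inversions_f \<xi>) \<longrightarrow> forces K w e (fill_f \<xi> B) \<longrightarrow> forces K w e (fill_f \<xi> A))"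
proof (induction \<Xi> and \<xi> arbitrary: w e and w e)
  case (Ctx \<Psi> \<xi>)
  from Ctx.IH[OF Ctx.prems(1-3)] Ctx.prems(4) show ?case
    by auto
next
  case Hole
  then show ?case
    using local by auto
next
  case (In_Pistil x \<Xi> \<Delta>)
  have w: "w \<in> worlds K" and x: "fset x \<subseteq> X" and \<Xi>: "bv (fill \<Xi> {#}) \<subseteq> X"
    using In_Pistil.prems by (auto simp: bv_garden_bv simp del: bv_garden.simps)
  have "(positive \<Xi> \<longrightarrow> forces K w' e' (fill \<Xi> A) \<longrightarrow> forces K w' e' (fill \<Xi> B)) \<and>
      (negative \<Xi> \<longrightarrow> forces K w' e' (fill \<Xi> B) \<longrightarrow> forces K w' e' (fill \<Xi> A))"
    if "w \<preceq> w'" "evaluation K w' e'" "\<forall>v. v \<notin> fset x \<longrightarrow> e' v = e v" for w' e'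
  proof (rule In_Pistil.IH[OF _ _ _ \<Xi>])
    show "w\<^sub>0 \<preceq> w'"
      using In_Pistil.prems(1) that(1) accessible_trans by blast
    show "e' v = e\<^sub>0 v" if "v \<notin> X" for v
      using that \<open>\<forall>v. v \<notin> fset x \<longrightarrow> e' v = e v\<close> In_Pistil.prems(3) x by (metis subsetD)
  qed (rule that(2))
  \<comment> \<open>The parity flips and the pistil is contravariant, so each half of the goal comes
    from the half of the induction hypothesis for the opposite parity.\<close>
  then show ?case
    by (auto intro: forces_flower_mono[OF _ w In_Pistil.prems(2)])
next
  case (In_Petal \<gamma> y \<Xi> \<Delta>)
  obtain x \<Phi> where \<gamma>: "\<gamma> = x \<cdot> \<Phi>"
    by (cases \<gamma>)
  have w: "w \<in> worlds K" and x: "fset x \<subseteq> X" and y: "fset y \<subseteq> X" and \<Xi>: "bv (fill \<Xi> {#}) \<subseteq> X"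
    using In_Petal.prems by (auto simp: \<gamma> bv_garden_bv simp del: bv_garden.simps)
  \<comment> \<open>Two sprinklers lie above the hole: \<open>e'\<close> varies \<open>e\<close> on
    \<open>x\<close>, then \<open>e''\<close> varies \<open>e'\<close> on \<open>y\<close>. Both
    sets lie in \<open>X\<close>, so agreement with \<open>e\<^sub>0\<close> outside
    \<open>X\<close> survives.\<close>
  have inner: "(positive \<Xi> \<longrightarrow> forces K w' e'' (fill \<Xi> A) \<longrightarrow> forces K w' e'' (fill \<Xi> B)) \<and>
      (negative \<Xi> \<longrightarrow> forces K w' e'' (fill \<Xi> B) \<longrightarrow> forces K w' e'' (fill \<Xi> A))"
    if "w \<preceq> w'" "evaluation K w' e''" "\<forall>v. v \<notin> fset x \<longrightarrow> e' v = e v"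
      "\<forall>v. v \<notin> fset y \<longrightarrow> e'' v = e' v" for w' e' e''
  proof (rule In_Petal.IH[OF _ _ _ \<Xi>])
    show "w\<^sub>0 \<preceq> w'"
      using In_Petal.prems(1) that(1) accessible_trans by blast
    show "e'' v = e\<^sub>0 v" if "v \<notin> X" for v
      using that \<open>\<forall>v. v \<notin> fset x \<longrightarrow> e' v = e v\<close> \<open>\<forall>v. v \<notin> fset y \<longrightarrow> e'' v = e' v\<close>
        In_Petal.prems(3) x y by (metis subsetD)
  qed (rule that(2))
  have "(positive \<Xi> \<longrightarrow> forces_garden w' e' (y \<cdot> fill \<Xi> A) \<longrightarrow> forces_garden w' e' (y \<cdot> fill \<Xi> B)) \<and>
      (negative \<Xi> \<longrightarrow> forces_garden w' e' (y \<cdot> fill \<Xi> B) \<longrightarrow> forces_garden w' e' (y \<cdot> fill \<Xi> A))"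
    if "w \<preceq> w'" "evaluation K w' e'" "\<forall>v. v \<notin> fset x \<longrightarrow> e' v = e v" for w' e'
    unfolding forces_garden_variant[OF that(2)] using inner[OF that(1) _ that(3)] by blast
  then show ?case
    unfolding \<gamma>
    by (auto elim!: forces_flower_mono[OF _ w In_Petal.prems(2)] simp del: forces_garden.simps)
qed

section \<open>Entailment in the fixed model\<close>

definition entails_in :: "('v, 'p) bouquet \<Rightarrow> ('v, 'p) bouquet \<Rightarrow> bool" (infix "\<turnstile>" 50) where
  "A \<turnstile> B \<longleftrightarrow> (\<forall>w e. w \<in> worlds K \<longrightarrow> evaluation K w e \<longrightarrow> forces K w e A \<longrightarrow> forces K w e B)"

lemma entails_in_refl: "A \<turnstile> A"
  by (simp add: entails_in_def)

lemma entails_in_empty: "A \<turnstile> {#}"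
  by (simp add: entails_in_def)

lemma entails_in_trans: "A \<turnstile> B \<Longrightarrow> B \<turnstile> C \<Longrightarrow> A \<turnstile> C"
  unfolding entails_in_def by blast

lemma entails_in_fill:
  assumes "A \<turnstile> B"
  shows "positive \<Xi> \<Longrightarrow> fill \<Xi> A \<turnstile> fill \<Xi> B" and "negative \<Xi> \<Longrightarrow> fill \<Xi> B \<turnstile> fill \<Xi> A"
proof -
  have "(positive \<Xi> \<longrightarrow> forces K w e (fill \<Xi> A) \<longrightarrow> forces K w e (fill \<Xi> B)) \<and>
      (negative \<Xi> \<longrightarrow> forces K w e (fill \<Xi> B) \<longrightarrow> forces K w e (fill \<Xi> A))"
    if "w \<in> worlds K" "evaluation K w e" for w e
    by (rule forces_fill_local(1)[where X = UNIV and w\<^sub>0 = w and e\<^sub>0 = e])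
      (use that assms accessible_refl in \<open>auto simp: entails_in_def\<close>)
  then show "positive \<Xi> \<Longrightarrow> fill \<Xi> A \<turnstile> fill \<Xi> B" "negative \<Xi> \<Longrightarrow> fill \<Xi> B \<turnstile> fill \<Xi> A"
    by (auto simp: entails_in_def)
qed

text \<open>Every context is positive or negative, and an equivalence offers the entailment that
  either parity asks for.\<close>

lemma equivalent_fill:
  assumes "A \<turnstile> B" "B \<turnstile> A"
  shows "fill \<Xi> A \<turnstile> fill \<Xi> B"
  using entails_in_fill assms by blast

section \<open>Pollination\<close>

text \<open>Dropping \<open>\<phi>\<close> at the hole is always sound locally; adding it is sound
  because it remains forced there. Transporting both local entailments gives the equivalence for
  either parity.\<close>

lemma forces_fill_pollen:
  assumes w: "w \<in> worlds K" and e: "evaluation K w e" and \<phi>: "forces_flower K w e \<phi>"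
    and fresh: "bv (fill \<Xi> {#}) \<inter> fv_flower \<phi> = {}"
  shows "forces K w e (fill \<Xi> (add_mset \<phi> \<Theta>)) \<longleftrightarrow> forces K w e (fill \<Xi> \<Theta>)"
proof -
  have *: "forces_flower K w' e' \<phi>"
    if "w \<preceq> w'" "\<And>v. v \<notin> bv (fill \<Xi> {#}) \<Longrightarrow> e' v = e v" for w' e'
  proof -
    have "forces_flower K w' e' \<phi> \<longleftrightarrow> forces_flower K w' e \<phi>"
      by (rule forces_flower_cong_fv) (use that fresh in blast)
    then show ?thesis
      using forces_flower_persistent[OF \<phi> that(1)] by blast
  qed
  have refl: "w \<preceq> w"
    using accessible_refl[OF w] .
  have "(positive \<Xi> \<longrightarrow> forces K w e (fill \<Xi> (add_mset \<phi> \<Theta>)) \<longrightarrow> forces K w e (fill \<Xi> \<Theta>)) \<and>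
      (negative \<Xi> \<longrightarrow> forces K w e (fill \<Xi> \<Theta>) \<longrightarrow> forces K w e (fill \<Xi> (add_mset \<phi> \<Theta>)))"
    by (rule forces_fill_local(1)[OF _ refl e _ order_refl, where e\<^sub>0 = e]) auto
  moreover have "(positive \<Xi> \<longrightarrow> forces K w e (fill \<Xi> \<Theta>) \<longrightarrow> forces K w e (fill \<Xi> (add_mset \<phi> \<Theta>))) \<and>
      (negative \<Xi> \<longrightarrow> forces K w e (fill \<Xi> (add_mset \<phi> \<Theta>)) \<longrightarrow> forces K w e (fill \<Xi> \<Theta>))"
    by (rule forces_fill_local(1)[OF _ refl e _ order_refl, where e\<^sub>0 = e]) (use * in auto)
  ultimately show ?thesis
    by blast
qed

text \<open>\<open>\<Theta>\<^sub>0\<close> is kept apart from \<open>\<Theta>\<close> because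
  capture freeness is known for a single filling, while \<open>\<phi>\<close> has to be added to
  arbitrary ones. The filling only witnesses that the context is fresh for
  \<open>\<phi>\<close>.\<close>

lemma pollinable_flower_equivalent:
  assumes cf: "capture_free (fill \<Xi> \<Theta>\<^sub>0)" and "pollinable_flower \<phi> \<Xi>"
  shows "fill \<Xi> (add_mset \<phi> \<Theta>) \<turnstile> fill \<Xi> \<Theta>" and "fill \<Xi> \<Theta> \<turnstile> fill \<Xi> (add_mset \<phi> \<Theta>)"
proof -
  from assms(2) obtain \<Psi> \<Xi>' \<Xi>\<^sub>0 where \<phi>: "\<phi> \<in># \<Psi>" and
    \<Xi>: "\<Xi> = fill_ctx \<Xi>' (juxtapose \<Psi> \<Xi>\<^sub>0) \<or>
      (\<exists>x y \<Delta>. \<Xi> = fill_ctx \<Xi>' (Ctx {#} (In_Petal (x \<cdot> \<Psi>) y \<Xi>\<^sub>0 \<Delta>)))"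
    unfolding pollinable_flower_def by blast
  \<comment> \<open>\<open>\<Xi>\<^sub>1\<close> is the inner part of the context, cut off so that
    it still contains the source of the pollen. The equivalence holds outright for it, and the outer
    part \<open>\<Xi>'\<close> then preserves it.\<close>
  have "\<exists>\<Xi>\<^sub>1. \<Xi> = fill_ctx \<Xi>' \<Xi>\<^sub>1 \<and> (\<forall>w e. w \<in> worlds K \<longrightarrow> evaluation K w e \<longrightarrow>
      (forces K w e (fill \<Xi>\<^sub>1 (add_mset \<phi> \<Theta>)) \<longleftrightarrow> forces K w e (fill \<Xi>\<^sub>1 \<Theta>)))"
    using \<Xi>
  proof (elim disjE exE)
    assume eq: "\<Xi> = fill_ctx \<Xi>' (juxtapose \<Psi> \<Xi>\<^sub>0)"
    have "capture_free (\<Psi> + fill \<Xi>\<^sub>0 \<Theta>\<^sub>0)"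
      using cf capture_free_fill(1) by (simp add: eq fill_fill_ctx fill_juxtapose) blast
    then have "bv (fill \<Xi>\<^sub>0 {#}) \<inter> fv_flower \<phi> = {}"
      using capture_free_union bv_fill_mono(1)[of \<Xi>\<^sub>0 \<Theta>\<^sub>0] \<phi> by (fastforce simp: fv_def)
    then have "forces K w e (fill (juxtapose \<Psi> \<Xi>\<^sub>0) (add_mset \<phi> \<Theta>)) \<longleftrightarrow>
        forces K w e (fill (juxtapose \<Psi> \<Xi>\<^sub>0) \<Theta>)" if "w \<in> worlds K" "evaluation K w e" for w e
      using forces_fill_pollen[OF that, of \<phi> \<Xi>\<^sub>0 \<Theta>] \<phi>
      by (auto simp: fill_juxtapose forces_def[of K w e \<Psi>])
    then show ?thesis
      using eq by blast
  next
    fix x y \<Delta> assume eq: "\<Xi> = fill_ctx \<Xi>' (Ctx {#} (In_Petal (x \<cdot> \<Psi>) y \<Xi>\<^sub>0 \<Delta>))"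
    have "capture_free {# x \<cdot> \<Psi> \<rhd> add_mset (y \<cdot> fill \<Xi>\<^sub>0 \<Theta>\<^sub>0) \<Delta> #}"
      using cf capture_free_fill(1) by (simp add: eq fill_fill_ctx) blast
    from capture_free_petal(2)[OF this]
    have y: "fset y \<inter> fv_flower \<phi> = {}" and \<Xi>\<^sub>0: "bv (fill \<Xi>\<^sub>0 {#}) \<inter> fv_flower \<phi> = {}"
      using bv_fill_mono(1)[of \<Xi>\<^sub>0 \<Theta>\<^sub>0] \<phi> unfolding bv_garden_bv fv_def by blast+
    \<comment> \<open>Within the clause of the flower the pistil \<open>\<Psi>\<close> may be
      assumed forced, hence \<open>\<phi>\<close> too; freshness of \<open>y\<close> carries
      \<open>\<phi>\<close> into the petal.\<close>
    have garden: "forces_garden w e (y \<cdot> fill \<Xi>\<^sub>0 (add_mset \<phi> \<Theta>)) \<longleftrightarrow> forces_garden w e (y \<cdot> fill \<Xi>\<^sub>0 \<Theta>)"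
      if "w \<in> worlds K" "evaluation K w e" "forces K w e \<Psi>" for w e
    proof -
      have "forces_flower K w (override_on e e' (fset y)) \<phi> \<longleftrightarrow> forces_flower K w e \<phi>" for e'
        by (rule forces_flower_cong_fv) (use y in \<open>auto simp: override_on_def\<close>)
      then have "forces_flower K w (override_on e e' (fset y)) \<phi>" for e'
        using that(3) \<phi> by (auto simp: forces_def)
      then show ?thesis
        using forces_fill_pollen[OF that(1) evaluation_override[OF that(2)] _ \<Xi>\<^sub>0] by auto
    qed
    have "forces K w e (fill (Ctx {#} (In_Petal (x \<cdot> \<Psi>) y \<Xi>\<^sub>0 \<Delta>)) (add_mset \<phi> \<Theta>)) \<longleftrightarrow>
        forces K w e (fill (Ctx {#} (In_Petal (x \<cdot> \<Psi>) y \<Xi>\<^sub>0 \<Delta>)) \<Theta>)"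
      if "w \<in> worlds K" "evaluation K w e" for w e
    proof -
      let ?A = "add_mset (y \<cdot> fill \<Xi>\<^sub>0 (add_mset \<phi> \<Theta>)) \<Delta>" and ?B = "add_mset (y \<cdot> fill \<Xi>\<^sub>0 \<Theta>) \<Delta>"
      have *: "forces_some w' e' ?A \<longleftrightarrow> forces_some w' e' ?B"
        if "w \<preceq> w'" "evaluation K w' e'" "forces K w' e' \<Psi>" for w' e'
        unfolding forces_some_add_mset using garden that by blast
      have "forces_flower K w e (x \<cdot> \<Psi> \<rhd> ?A) \<longleftrightarrow> forces_flower K w e (x \<cdot> \<Psi> \<rhd> ?B)"
        unfolding forces_flower_variant[OF that] using * by blast
      then show ?thesis
        by simp
    qed
    then show ?thesis
      using eq by blast
  qed
  then obtain \<Xi>\<^sub>1 where \<Xi>\<^sub>1: "\<Xi> = fill_ctx \<Xi>' \<Xi>\<^sub>1"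
    "fill \<Xi>\<^sub>1 (add_mset \<phi> \<Theta>) \<turnstile> fill \<Xi>\<^sub>1 \<Theta>" "fill \<Xi>\<^sub>1 \<Theta> \<turnstile> fill \<Xi>\<^sub>1 (add_mset \<phi> \<Theta>)"
    by (auto simp: entails_in_def)
  then show "fill \<Xi> (add_mset \<phi> \<Theta>) \<turnstile> fill \<Xi> \<Theta>" "fill \<Xi> \<Theta> \<turnstile> fill \<Xi> (add_mset \<phi> \<Theta>)"
    using equivalent_fill by (simp_all add: fill_fill_ctx)
qed

text \<open>Flowers are inserted one at a time, all with the same witness \<open>\<Theta>\<close> of
  capture freeness: \<open>\<Phi>\<close> itself for \<open>poll_down\<close>, the empty bouquet for
  \<open>poll_up\<close>.\<close>

lemma pollinable_equivalent:
  assumes "capture_free (fill \<Xi> \<Theta>)" and "pollinable \<Phi> \<Xi>"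
  shows "fill \<Xi> \<Phi> \<turnstile> fill \<Xi> {#} \<and> fill \<Xi> {#} \<turnstile> fill \<Xi> \<Phi>"
  using assms(2)
proof (induction \<Phi>)
  case empty
  then show ?case
    by (simp add: entails_in_refl)
next
  case (add \<phi> \<Phi>)
  then have "pollinable_flower \<phi> \<Xi>" and IH: "fill \<Xi> \<Phi> \<turnstile> fill \<Xi> {#}" "fill \<Xi> {#} \<turnstile> fill \<Xi> \<Phi>"
    by (auto simp: pollinable_def)
  from pollinable_flower_equivalent[OF assms(1) this(1), of \<Phi>] IH show ?case
    by (blast intro: entails_in_trans)
qed

section \<open>Instantiation and renaming\<close>

text \<open>Universal instantiation. If \<open>e'\<close> varies \<open>e\<close> on
  \<open>x\<close>, then \<open>e' \<circ> \<sigma>\<close> varies \<open>e\<close> on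
  \<open>x\<close> and \<open>y\<close>, as \<open>\<sigma>\<close> fixes all variables outside
  \<open>y\<close>; the substitution lemmas translate pistil and petals.\<close>

lemma forces_pistil_instance:
  assumes \<sigma>: "subst_on \<sigma> y" "capture_avoiding \<sigma> y {# {||} \<cdot> \<Phi> \<rhd> \<Delta> #}"
  shows "{# (x |\<union>| y) \<cdot> \<Phi> \<rhd> \<Delta> #} \<turnstile> {# x \<cdot> subst \<sigma> \<Phi> \<rhd> subst_corolla \<sigma> \<Delta> #}"
proof -
  have \<Phi>: "\<sigma> v \<notin> bv \<Phi>" and \<Delta>: "\<delta> \<in># \<Delta> \<Longrightarrow> \<sigma> v \<notin> bv_garden \<delta>" if "\<sigma> v \<noteq> v" for v \<delta>
    using \<sigma> that by (force simp: subst_on_def capture_avoiding_def bv_def)+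
  have "forces_some w' e' (subst_corolla \<sigma> \<Delta>)"
    if w: "w \<in> worlds K" and e: "evaluation K w e"
      and f: "forces_flower K w e ((x |\<union>| y) \<cdot> \<Phi> \<rhd> \<Delta>)"
      and w': "w \<preceq> w'" and e': "evaluation K w' e'" "\<forall>v. v \<notin> fset x \<longrightarrow> e' v = e v"
      and \<Phi>': "forces K w' e' (subst \<sigma> \<Phi>)" for w e w' e'
  proof -
    have "(e' \<circ> \<sigma>) v = e v" if "v \<notin> fset (x |\<union>| y)" for v
    proof -
      have "\<sigma> v = v"
        using \<sigma>(1) that by (auto simp: subst_on_def)
      then show ?thesis
        using e'(2) that by simp
    qed
    moreover have "forces K w' (e' \<circ> \<sigma>) \<Phi>"
      using \<Phi>' forces_subst[of \<sigma> \<Phi> w' e'] \<Phi> by blast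
    ultimately have "forces_some w' (e' \<circ> \<sigma>) \<Delta>"
      using f[unfolded forces_flower_variant[OF w e]] w' evaluation_comp[OF e'(1)] by blast
    then show ?thesis
      using forces_some_subst[of \<sigma> \<Delta> w' e'] \<Delta> by blast
  qed
  then have "forces_flower K w e (x \<cdot> subst \<sigma> \<Phi> \<rhd> subst_corolla \<sigma> \<Delta>)"
    if "w \<in> worlds K" "evaluation K w e" "forces_flower K w e ((x |\<union>| y) \<cdot> \<Phi> \<rhd> \<Delta>)" for w e
    unfolding forces_flower_variant[OF that(1,2)] using that by blast
  then show ?thesis
    unfolding entails_in_def by simp
qed

text \<open>Existential generalization, dual to the pistil case: the witness for the larger
  sprinkler is again \<open>e' \<circ> \<sigma>\<close>.\<close>

lemma forces_garden_instance:
  assumes \<sigma>: "subst_on \<sigma> y" "capture_avoiding \<sigma> y \<Phi>"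
    and e: "evaluation K w e" and f: "forces_garden w e (x \<cdot> subst \<sigma> \<Phi>)"
  shows "forces_garden w e ((x |\<union>| y) \<cdot> \<Phi>)"
proof -
  from f obtain e' where e': "evaluation K w e'" "\<forall>v. v \<notin> fset x \<longrightarrow> e' v = e v"
    "forces K w e' (subst \<sigma> \<Phi>)"
    unfolding forces_garden_variant[OF e] by blast
  have "\<sigma> v \<notin> bv \<Phi>" if "\<sigma> v \<noteq> v" for v
    using \<sigma> that by (force simp: subst_on_def capture_avoiding_def)
  then have "forces K w (e' \<circ> \<sigma>) \<Phi>"
    using e'(3) forces_subst by blast
  moreover have "(e' \<circ> \<sigma>) v = e v" if "v \<notin> fset (x |\<union>| y)" for v
  proof -
    have "\<sigma> v = v"
      using \<sigma>(1) that by (auto simp: subst_on_def)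
    then show ?thesis
      using e'(2) that by simp
  qed
  ultimately show ?thesis
    unfolding forces_garden_variant[OF e] using evaluation_comp[OF e'(1)] by blast
qed

lemma corolla_entails:
  assumes "\<And>w e. w \<in> worlds K \<Longrightarrow> evaluation K w e \<Longrightarrow> forces_some w e \<Delta> \<Longrightarrow> forces_some w e \<Delta>'"
  shows "{# \<gamma> \<rhd> \<Delta> #} \<turnstile> {# \<gamma> \<rhd> \<Delta>' #}"
proof (cases \<gamma>)
  case (Garden x \<Phi>)
  have "forces_flower K w e (x \<cdot> \<Phi> \<rhd> \<Delta>')"
    if "w \<in> worlds K" "evaluation K w e" "forces_flower K w e (x \<cdot> \<Phi> \<rhd> \<Delta>)" for w e
    by (rule forces_flower_mono[OF that(3,1,2)]) (use assms in blast)+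
  then show ?thesis
    unfolding entails_in_def Garden by simp
qed

lemma renamed_variants:
  assumes inj: "inj_on \<sigma> X" and off: "\<forall>v. v \<notin> X \<longrightarrow> \<sigma> v = v"
    and fresh: "F \<inter> \<sigma> ` X \<subseteq> X"
    and e: "evaluation K w e"
  shows "evaluation K w e\<^sub>1 \<Longrightarrow> (\<forall>v. v \<notin> \<sigma> ` X \<longrightarrow> e\<^sub>1 v = e v) \<Longrightarrow>
      \<exists>e\<^sub>2. evaluation K w e\<^sub>2 \<and> (\<forall>v. v \<notin> X \<longrightarrow> e\<^sub>2 v = e v) \<and> (\<forall>v\<in>F. (e\<^sub>1 \<circ> \<sigma>) v = e\<^sub>2 v)"
    and "evaluation K w e\<^sub>2 \<Longrightarrow> (\<forall>v. v \<notin> X \<longrightarrow> e\<^sub>2 v = e v) \<Longrightarrow>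
      \<exists>e\<^sub>1. evaluation K w e\<^sub>1 \<and> (\<forall>v. v \<notin> \<sigma> ` X \<longrightarrow> e\<^sub>1 v = e v) \<and> (\<forall>v\<in>F. (e\<^sub>1 \<circ> \<sigma>) v = e\<^sub>2 v)"
proof -
  assume *: "evaluation K w e\<^sub>1" "\<forall>v. v \<notin> \<sigma> ` X \<longrightarrow> e\<^sub>1 v = e v"
  show "\<exists>e\<^sub>2. evaluation K w e\<^sub>2 \<and> (\<forall>v. v \<notin> X \<longrightarrow> e\<^sub>2 v = e v) \<and> (\<forall>v\<in>F. (e\<^sub>1 \<circ> \<sigma>) v = e\<^sub>2 v)"
  proof (intro exI[of _ "override_on e (e\<^sub>1 \<circ> \<sigma>) X"] conjI ballI)
    fix v assume "v \<in> F"
    then show "(e\<^sub>1 \<circ> \<sigma>) v = override_on e (e\<^sub>1 \<circ> \<sigma>) X v"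
      using * off fresh by (cases "v \<in> X") auto
  qed (use evaluation_override[OF e evaluation_comp] * in auto)
next
  assume *: "evaluation K w e\<^sub>2" "\<forall>v. v \<notin> X \<longrightarrow> e\<^sub>2 v = e v"
  show "\<exists>e\<^sub>1. evaluation K w e\<^sub>1 \<and> (\<forall>v. v \<notin> \<sigma> ` X \<longrightarrow> e\<^sub>1 v = e v) \<and> (\<forall>v\<in>F. (e\<^sub>1 \<circ> \<sigma>) v = e\<^sub>2 v)"
  \<comment> \<open>A renamed variable takes the value of its unique preimage in \<open>X\<close>. A
    variable of \<open>F\<close> outside \<open>X\<close> is fixed by \<open>\<sigma>\<close> and is
    not in the image, so it keeps its value under \<open>e\<close>.\<close>
  proof (intro exI[of _ "override_on e (e\<^sub>2 \<circ> inv_into X \<sigma>) (\<sigma> ` X)"] conjI ballI)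
    fix v assume "v \<in> F"
    then show "(override_on e (e\<^sub>2 \<circ> inv_into X \<sigma>) (\<sigma> ` X) \<circ> \<sigma>) v = e\<^sub>2 v"
      using * off fresh inj by (cases "v \<in> X") (auto simp: override_on_def)
  qed (use evaluation_override[OF e evaluation_comp] * in auto)
qed

text \<open>Only the part \<open>y\<close> of the sprinkler moves, and its new names avoid
  \<open>x\<close>, so a moved and an unmoved variable never collide. The last claim is the
  freshness condition of \<open>renamed_variants\<close> with \<open>F\<close> the complement of the
  new names.\<close>

lemma subst_on_inj_on:
  assumes "subst_on \<sigma> y" "y |\<subseteq>| x" "inj_on \<sigma> (fset y)" "\<sigma> ` fset y \<inter> fset x = {}"
  shows "inj_on \<sigma> (fset x)" and "\<forall>v. v \<notin> fset x \<longrightarrow> \<sigma> v = v"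
    and "- (\<sigma> ` fset y) \<inter> \<sigma> ` fset x \<subseteq> fset x"
proof -
  have id: "\<sigma> v = v" if "v \<notin> fset y" for v
    using assms(1) that by (auto simp: subst_on_def)
  have sub: "fset y \<subseteq> fset x"
    using assms(2) by (simp add: less_eq_fset.rep_eq)
  show "inj_on \<sigma> (fset x)"
  proof (rule inj_onI)
    fix u v assume uv: "u \<in> fset x" "v \<in> fset x" "\<sigma> u = \<sigma> v"
    have "\<sigma> w \<notin> fset x" if "w \<in> fset y" for w
      using assms(4) that by blast
    then have "u \<in> fset y \<longleftrightarrow> v \<in> fset y"
      using uv id by metis
    then show "u = v"
      using uv(3) id[of u] id[of v] inj_onD[OF assms(3) uv(3)] by metis
  qed
  show "\<forall>v. v \<notin> fset x \<longrightarrow> \<sigma> v = v"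
    using id sub by blast
  show "- (\<sigma> ` fset y) \<inter> \<sigma> ` fset x \<subseteq> fset x"
  proof
    fix u assume "u \<in> - (\<sigma> ` fset y) \<inter> \<sigma> ` fset x"
    then obtain v where "u = \<sigma> v" "v \<in> fset x" "v \<notin> fset y"
      by blast
    then show "u \<in> fset x"
      using id[of v] by simp
  qed
qed

text \<open>Matched variants force corresponding pistils and corollas, by the substitution lemmas
  and dependence on free variables; freshness puts all free variables involved into
  \<open>F\<close>.\<close>

lemma rename_pistil_equivalent:
  assumes \<sigma>: "subst_on \<sigma> y" "y |\<subseteq>| x" "inj_on \<sigma> (fset y)"
    and fresh: "\<sigma> ` fset y \<inter> (fv_flower (x \<cdot> \<Phi> \<rhd> \<Delta>) \<union> bv_flower (x \<cdot> \<Phi> \<rhd> \<Delta>)) = {}"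
    and w: "w \<in> worlds K" and e: "evaluation K w e"
  shows "forces_flower K w e (x \<cdot> \<Phi> \<rhd> \<Delta>) \<longleftrightarrow>
    forces_flower K w e ((\<sigma> |`| x) \<cdot> subst \<sigma> \<Phi> \<rhd> subst_corolla \<sigma> \<Delta>)"
proof -
  define F where "F = - (\<sigma> ` fset y)"
  have fresh_x: "\<sigma> ` fset y \<inter> fset x = {}"
    using fresh by auto
  note \<sigma>' = subst_on_inj_on[OF \<sigma> fresh_x]
  have \<Phi>: "\<sigma> v \<notin> bv \<Phi>" and \<Delta>: "\<delta> \<in># \<Delta> \<Longrightarrow> \<sigma> v \<notin> bv_garden \<delta>" if "\<sigma> v \<noteq> v" for v \<delta>
    using \<sigma>(1) fresh that by (force simp: subst_on_def bv_def)+
  have fv\<Phi>: "fv \<Phi> \<subseteq> F" and fv\<Delta>: "\<delta> \<in># \<Delta> \<Longrightarrow> fv_garden \<delta> \<subseteq> F" for \<delta>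
    using fresh fresh_x fv_pistil_subset[of \<Phi> x \<Delta>] fv_petal_subset[of \<delta> \<Delta> x \<Phi>]
    unfolding F_def by blast+
  have transfer: "forces K w' e\<^sub>1 (subst \<sigma> \<Phi>) \<longleftrightarrow> forces K w' e\<^sub>2 \<Phi>"
    "forces_some w' e\<^sub>1 (subst_corolla \<sigma> \<Delta>) \<longleftrightarrow> forces_some w' e\<^sub>2 \<Delta>"
    if "\<forall>v\<in>F. (e\<^sub>1 \<circ> \<sigma>) v = e\<^sub>2 v" for w' e\<^sub>1 e\<^sub>2
  proof -
    have "forces K w' (e\<^sub>1 \<circ> \<sigma>) \<Phi> \<longleftrightarrow> forces K w' e\<^sub>2 \<Phi>"
      by (rule forces_cong_fv) (use that fv\<Phi> in blast)
    then show "forces K w' e\<^sub>1 (subst \<sigma> \<Phi>) \<longleftrightarrow> forces K w' e\<^sub>2 \<Phi>"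
      using forces_subst[of \<sigma> \<Phi> w' e\<^sub>1] \<Phi> by blast
    have "forces_some w' (e\<^sub>1 \<circ> \<sigma>) \<Delta> \<longleftrightarrow> forces_some w' e\<^sub>2 \<Delta>"
      by (rule forces_some_cong_fv) (use that fv\<Delta> in blast)
    then show "forces_some w' e\<^sub>1 (subst_corolla \<sigma> \<Delta>) \<longleftrightarrow> forces_some w' e\<^sub>2 \<Delta>"
      using forces_some_subst[of \<sigma> \<Delta> w' e\<^sub>1] \<Delta> by blast
  qed
  note variants = renamed_variants[OF \<sigma>'[folded F_def] evaluation_mono[OF _ e]]
  show ?thesis (is "?L \<longleftrightarrow> ?R")
  proof
    assume L: ?L
    show ?R
      unfolding forces_flower_variant[OF w e] fimage.rep_eq
    proof (intro allI impI)
      fix w' e\<^sub>1 assume a: "w \<preceq> w'" "evaluation K w' e\<^sub>1" "\<forall>v. v \<notin> \<sigma> ` fset x \<longrightarrow> e\<^sub>1 v = e v"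
        "forces K w' e\<^sub>1 (subst \<sigma> \<Phi>)"
      obtain e\<^sub>2 where b: "evaluation K w' e\<^sub>2" "\<forall>v. v \<notin> fset x \<longrightarrow> e\<^sub>2 v = e v"
        "\<forall>v\<in>F. (e\<^sub>1 \<circ> \<sigma>) v = e\<^sub>2 v"
        using variants(1)[OF a(1-3)] by blast
      have "forces_some w' e\<^sub>2 \<Delta>"
        using L[unfolded forces_flower_variant[OF w e]] a(1,4) b(1,2) transfer(1)[OF b(3)] by blast
      then show "forces_some w' e\<^sub>1 (subst_corolla \<sigma> \<Delta>)"
        using transfer(2)[OF b(3)] by blast
    qed
  next
    assume R: ?R
    show ?L
      unfolding forces_flower_variant[OF w e]
    proof (intro allI impI)
      fix w' e\<^sub>2 assume a: "w \<preceq> w'" "evaluation K w' e\<^sub>2" "\<forall>v. v \<notin> fset x \<longrightarrow> e\<^sub>2 v = e v"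
        "forces K w' e\<^sub>2 \<Phi>"
      obtain e\<^sub>1 where b: "evaluation K w' e\<^sub>1" "\<forall>v. v \<notin> \<sigma> ` fset x \<longrightarrow> e\<^sub>1 v = e v"
        "\<forall>v\<in>F. (e\<^sub>1 \<circ> \<sigma>) v = e\<^sub>2 v"
        using variants(2)[OF a(1-3)] by blast
      have "forces_some w' e\<^sub>1 (subst_corolla \<sigma> \<Delta>)"
        using R[unfolded forces_flower_variant[OF w e] fimage.rep_eq] a(1,4) b(1,2) transfer(1)[OF b(3)]
        by blast
      then show "forces_some w' e\<^sub>2 \<Delta>"
        using transfer(2)[OF b(3)] by blast
    qed
  qed
qed

lemma rename_petal_equivalent:
  assumes \<sigma>: "subst_on \<sigma> y" "y |\<subseteq>| x" "inj_on \<sigma> (fset y)"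
    and fresh: "\<sigma> ` fset y \<inter> (fv_garden (x \<cdot> \<Phi>) \<union> bv_garden (x \<cdot> \<Phi>)) = {}"
    and e: "evaluation K w e"
  shows "forces_garden w e (x \<cdot> \<Phi>) \<longleftrightarrow> forces_garden w e ((\<sigma> |`| x) \<cdot> subst \<sigma> \<Phi>)"
proof -
  define F where "F = - (\<sigma> ` fset y)"
  have fresh_x: "\<sigma> ` fset y \<inter> fset x = {}"
    using fresh by auto
  note \<sigma>' = subst_on_inj_on[OF \<sigma> fresh_x]
  have \<Phi>: "\<sigma> v \<notin> bv \<Phi>" if "\<sigma> v \<noteq> v" for v
    using \<sigma>(1) fresh that by (force simp: subst_on_def bv_def)
  have fv\<Phi>: "fv \<Phi> \<subseteq> F"
    using fresh fresh_x by (auto simp: F_def)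
  have transfer: "forces K w e\<^sub>1 (subst \<sigma> \<Phi>) \<longleftrightarrow> forces K w e\<^sub>2 \<Phi>"
    if "\<forall>v\<in>F. (e\<^sub>1 \<circ> \<sigma>) v = e\<^sub>2 v" for e\<^sub>1 e\<^sub>2
  proof -
    have "forces K w (e\<^sub>1 \<circ> \<sigma>) \<Phi> \<longleftrightarrow> forces K w e\<^sub>2 \<Phi>"
      by (rule forces_cong_fv) (use that fv\<Phi> in blast)
    then show ?thesis
      using forces_subst[of \<sigma> \<Phi> w e\<^sub>1] \<Phi> by blast
  qed
  note variants = renamed_variants[OF \<sigma>'[folded F_def] e]
  show ?thesis (is "?L \<longleftrightarrow> ?R")
  proof
    assume ?L
    then obtain e\<^sub>2 where a: "evaluation K w e\<^sub>2" "\<forall>v. v \<notin> fset x \<longrightarrow> e\<^sub>2 v = e v" "forces K w e\<^sub>2 \<Phi>"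
      unfolding forces_garden_variant[OF e] by blast
    then show ?R
      unfolding forces_garden_variant[OF e] fimage.rep_eq
      using variants(2)[OF a(1,2)] transfer by blast
  next
    assume ?R
    then obtain e\<^sub>1 where a: "evaluation K w e\<^sub>1" "\<forall>v. v \<notin> \<sigma> ` fset x \<longrightarrow> e\<^sub>1 v = e v"
      "forces K w e\<^sub>1 (subst \<sigma> \<Phi>)"
      unfolding forces_garden_variant[OF e] fimage.rep_eq by blast
    then show ?L
      unfolding forces_garden_variant[OF e]
      using variants(1)[OF a(1,2)] transfer by blast
  qed
qed

lemma rename_sound:
  assumes "rename A B"
  shows "A \<turnstile> B \<and> B \<turnstile> A"
  using assms
proof cases
  case (rename_pistil \<sigma> y x \<Phi> \<Delta> \<Xi>)
  have "{# x \<cdot> \<Phi> \<rhd> \<Delta> #} \<turnstile> {# (\<sigma> |`| x) \<cdot> subst \<sigma> \<Phi> \<rhd> subst_corolla \<sigma> \<Delta> #}"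
    "{# (\<sigma> |`| x) \<cdot> subst \<sigma> \<Phi> \<rhd> subst_corolla \<sigma> \<Delta> #} \<turnstile> {# x \<cdot> \<Phi> \<rhd> \<Delta> #}"
    using rename_pistil_equivalent[OF rename_pistil(3-6)] by (simp_all add: entails_in_def)
  then show ?thesis
    unfolding rename_pistil(1,2) by (blast intro: equivalent_fill)
next
  case (rename_petal \<sigma> y x \<Phi> \<Xi> \<gamma> \<Delta>)
  have "{# \<gamma> \<rhd> {# x \<cdot> \<Phi> #} + \<Delta> #} \<turnstile> {# \<gamma> \<rhd> {# (\<sigma> |`| x) \<cdot> subst \<sigma> \<Phi> #} + \<Delta> #}"
    "{# \<gamma> \<rhd> {# (\<sigma> |`| x) \<cdot> subst \<sigma> \<Phi> #} + \<Delta> #} \<turnstile> {# \<gamma> \<rhd> {# x \<cdot> \<Phi> #} + \<Delta> #}"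
    by (rule corolla_entails; use rename_petal_equivalent[OF rename_petal(3-6)] in
        \<open>auto simp del: forces_garden.simps\<close>)+
  then show ?thesis
    unfolding rename_petal(1,2) by (blast intro: equivalent_fill)
qed

lemma alpha_equiv_sound:
  assumes "alpha_equiv A B"
  shows "A \<turnstile> B \<and> B \<turnstile> A"
  using assms
proof (induction rule: equivclp_induct)
  case base
  then show ?case
    by (simp add: entails_in_refl)
next
  case (step B C)
  then show ?case
    using rename_sound[of B C] rename_sound[of C B] by (blast intro: entails_in_trans)
qed

section \<open>Soundness\<close>

text \<open>The wrapped bouquet says that \<open>\<Phi>\<close> is forced at all later worlds, which
  persistence and reflexivity reduce to the present one.\<close>

lemma epis_equivalent:
  "\<Phi> \<turnstile> {# {||} \<cdot> {#} \<rhd> {# {||} \<cdot> \<Phi> #} #} \<and> {# {||} \<cdot> {#} \<rhd> {# {||} \<cdot> \<Phi> #} #} \<turnstile> \<Phi>"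
proof -
  have "forces_flower K w e ({||} \<cdot> {#} \<rhd> {# {||} \<cdot> \<Phi> #}) \<longleftrightarrow> (\<forall>w'. w \<preceq> w' \<longrightarrow> forces K w' e \<Phi>)"
    if "w \<in> worlds K" "evaluation K w e" for w e
    using evaluation_mono[OF _ that(2)] by (auto simp: forces_flower_override[OF that(1)])
  moreover have "(\<forall>w'. w \<preceq> w' \<longrightarrow> forces K w' e \<Phi>) \<longleftrightarrow> forces K w e \<Phi>" if "w \<in> worlds K" for w e
    using accessible_refl[OF that] forces_persistent[of w e \<Phi>] by blast
  ultimately show ?thesis
    by (simp add: entails_in_def)
qed

text \<open>An implication from a disjunction is a conjunction of implications. As
  \<open>\<Delta>\<close> ends up below the sprinklers of the gardens in \<open>\<Gamma>\<close>,
  these must avoid its free variables.\<close>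

lemma srep_equivalent:
  assumes cf: "capture_free {# x \<cdot> (\<Phi> + {# {||} \<cdot> {#} \<rhd> \<Gamma> #}) \<rhd> \<Delta> #}"
  shows "{# x \<cdot> (\<Phi> + {# {||} \<cdot> {#} \<rhd> \<Gamma> #}) \<rhd> \<Delta> #} \<turnstile>
      {# x \<cdot> \<Phi> \<rhd> {# {||} \<cdot> {# \<gamma> \<rhd> \<Delta>. \<gamma> \<in># \<Gamma> #} #} #}" (is "?A \<turnstile> ?B")
    and "{# x \<cdot> \<Phi> \<rhd> {# {||} \<cdot> {# \<gamma> \<rhd> \<Delta>. \<gamma> \<in># \<Gamma> #} #} #} \<turnstile>
      {# x \<cdot> (\<Phi> + {# {||} \<cdot> {#} \<rhd> \<Gamma> #}) \<rhd> \<Delta> #}"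
proof -
  \<comment> \<open>\<open>z\<close> is bound inside the pistil, so it avoids both \<open>x\<close>
    and the free variables of the whole flower, which together cover those of the petals.\<close>
  have fresh: "fset z \<inter> fv_garden \<delta> = {}" if "z \<cdot> \<Psi> \<in># \<Gamma>" "\<delta> \<in># \<Delta>" for z \<Psi> \<delta>
  proof -
    have "fset z \<subseteq> bv_garden (z \<cdot> \<Psi>)"
      by simp
    also have "\<dots> \<subseteq> bv (\<Phi> + {# {||} \<cdot> {#} \<rhd> \<Gamma> #})"
      unfolding bv_union bv_single bv_flower.simps using that(1) by blast
    finally have "fset z \<subseteq> bv (\<Phi> + {# {||} \<cdot> {#} \<rhd> \<Gamma> #})" .
    moreover have "bv (\<Phi> + {# {||} \<cdot> {#} \<rhd> \<Gamma> #}) \<inter> fset x = {}"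
      "bv (\<Phi> + {# {||} \<cdot> {#} \<rhd> \<Gamma> #}) \<inter> fv_flower (x \<cdot> (\<Phi> + {# {||} \<cdot> {#} \<rhd> \<Gamma> #}) \<rhd> \<Delta>) = {}"
      using cf by (auto simp: capture_free_def bv_garden_bv
          simp del: bv_union bv_garden.simps)
    ultimately show ?thesis
      using fv_petal_subset[OF that(2), of x "\<Phi> + {# {||} \<cdot> {#} \<rhd> \<Gamma> #}"] by blast
  qed
  have \<Delta>: "forces_some w (override_on e e' (fset z)) \<Delta> \<longleftrightarrow> forces_some w e \<Delta>"
    if "z \<cdot> \<Psi> \<in># \<Gamma>" for z \<Psi> w e e'
    by (rule forces_some_cong_fv) (use fresh[OF that] in \<open>auto simp: override_on_def\<close>)
  have \<Gamma>: "(forces_some w e \<Gamma> \<longrightarrow> forces_some w e \<Delta>)"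
    if "w \<in> worlds K" and f: "forces K w e {# \<gamma> \<rhd> \<Delta>. \<gamma> \<in># \<Gamma> #}" for w e
  proof
    assume "forces_some w e \<Gamma>"
    then obtain z \<Psi> where z: "z \<cdot> \<Psi> \<in># \<Gamma>" "forces_garden w e (z \<cdot> \<Psi>)"
      unfolding forces_some_def by (metis garden.exhaust)
    then have "forces_flower K w e (z \<cdot> \<Psi> \<rhd> \<Delta>)"
      using f by (auto simp: forces_def)
    then show "forces_some w e \<Delta>"
      using z \<Delta>[OF z(1)] accessible_refl[OF that(1)] by (auto simp: forces_flower_override[OF that(1)])
  qed
  have forces_pistil: "forces_flower K w e ({||} \<cdot> {#} \<rhd> \<Gamma>) \<longleftrightarrow> (\<forall>w'. w \<preceq> w' \<longrightarrow> forces_some w' e \<Gamma>)"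
    if "w \<in> worlds K" "evaluation K w e" for w e
    using evaluation_mono[OF _ that(2)] by (auto simp: forces_flower_override[OF that(1)])
  have forces_petal: "forces_some w e {# {||} \<cdot> \<Psi> #} \<longleftrightarrow> forces K w e \<Psi>"
    if "evaluation K w e" for w e \<Psi>
    using that by auto
  show "?A \<turnstile> ?B"
    unfolding entails_in_def
  proof (intro allI impI)
    fix w e assume w: "w \<in> worlds K" and e: "evaluation K w e" and "forces K w e ?A"
    then have A: "forces_some w' e' \<Delta>" if "w \<preceq> w'" "evaluation K w' e'"
      "\<forall>v. v \<notin> fset x \<longrightarrow> e' v = e v" "forces K w' e' \<Phi>" "\<forall>w''. w' \<preceq> w'' \<longrightarrow> forces_some w'' e' \<Gamma>" for w' e'
      using that by (auto simp: forces_flower_variant[OF w e] forces_pistil)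
    have "forces_flower K w' e' (\<gamma> \<rhd> \<Delta>)" if w': "w \<preceq> w'" and e': "evaluation K w' e'"
      and x: "\<forall>v. v \<notin> fset x \<longrightarrow> e' v = e v" and f: "forces K w' e' \<Phi>" and "\<gamma> \<in># \<Gamma>" for w' e' \<gamma>
    proof -
      obtain z \<Psi> where \<gamma>: "\<gamma> = z \<cdot> \<Psi>"
        by (cases \<gamma>)
      have "forces_some w'' (override_on e' e'' (fset z)) \<Delta>"
        if w'': "w' \<preceq> w''" and e'': "evaluation K w'' e''"
          and \<Psi>: "forces K w'' (override_on e' e'' (fset z)) \<Psi>" for w'' e''
      proof -
        \<comment> \<open>The witness \<open>e''\<close> for one garden of \<open>\<Gamma>\<close>
          persists, so the disjunction holds at every later world, as the flower in the pistil
          demands.\<close>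
        have "forces_some w\<^sub>3 e' \<Gamma>" if "w'' \<preceq> w\<^sub>3" for w\<^sub>3
          using forces_persistent[OF \<Psi> that] evaluation_mono[OF that e''] \<open>\<gamma> \<in># \<Gamma>\<close> \<gamma>
          unfolding forces_some_def by (metis forces_garden.simps)
        then have "forces_some w'' e' \<Delta>"
          using A[OF accessible_trans[OF w' w''] evaluation_mono[OF w'' e'] x forces_persistent[OF f w'']]
          by blast
        then show ?thesis
          using \<Delta> \<open>\<gamma> \<in># \<Gamma>\<close> \<gamma> by blast
      qed
      then show ?thesis
        using w' by (simp add: \<gamma> forces_flower_override)
    qed
    then have "forces K w' e' {# \<gamma> \<rhd> \<Delta>. \<gamma> \<in># \<Gamma> #}" if "w \<preceq> w'" "evaluation K w' e'"
      "\<forall>v. v \<notin> fset x \<longrightarrow> e' v = e v" "forces K w' e' \<Phi>" for w' e'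
      using that by (auto simp: forces_def)
    then show "forces K w e ?B"
      by (simp add: forces_flower_variant[OF w e] forces_petal del: forces_some_add_mset)
  qed
  show "?B \<turnstile> ?A"
    unfolding entails_in_def
  proof (intro allI impI)
    fix w e assume w: "w \<in> worlds K" and e: "evaluation K w e" and "forces K w e ?B"
    then have B: "forces K w' e' {# \<gamma> \<rhd> \<Delta>. \<gamma> \<in># \<Gamma> #}" if "w \<preceq> w'" "evaluation K w' e'"
      "\<forall>v. v \<notin> fset x \<longrightarrow> e' v = e v" "forces K w' e' \<Phi>" for w' e'
      using that by (simp add: forces_flower_variant[OF w e] forces_petal del: forces_some_add_mset)
    \<comment> \<open>By reflexivity the flower in the pistil yields the disjunction
      \<open>\<Gamma>\<close> at the present world, where the implications from \<open>B\<close>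
      finish by cases.\<close>
    show "forces K w e ?A"
      using B \<Gamma> accessible_refl by (simp add: forces_flower_variant[OF w e] forces_pistil)
  qed
qed

text \<open>An instance of a petal entails the petal, so as an extra disjunct it changes nothing.
  The third claim, where the instance stands alone, serves \<open>apet\<close>.\<close>

lemma ipet_equivalent:
  assumes "subst_on \<sigma> y" "capture_avoiding \<sigma> y \<Phi>"
  shows "{# \<gamma> \<rhd> {# x \<cdot> subst \<sigma> \<Phi>, (x |\<union>| y) \<cdot> \<Phi> #} + \<Delta> #} \<turnstile> {# \<gamma> \<rhd> {# (x |\<union>| y) \<cdot> \<Phi> #} + \<Delta> #}"
    and "{# \<gamma> \<rhd> {# (x |\<union>| y) \<cdot> \<Phi> #} + \<Delta> #} \<turnstile> {# \<gamma> \<rhd> {# x \<cdot> subst \<sigma> \<Phi>, (x |\<union>| y) \<cdot> \<Phi> #} + \<Delta> #}"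
    and "{# \<gamma> \<rhd> {# x \<cdot> subst \<sigma> \<Phi> #} + \<Delta> #} \<turnstile> {# \<gamma> \<rhd> {# (x |\<union>| y) \<cdot> \<Phi> #} + \<Delta> #}"
  by (rule corolla_entails; use forces_garden_instance[OF assms] in
      \<open>auto simp del: forces_garden.simps\<close>)+

section \<open>Soundness of rules, steps and sequences of steps\<close>

lemma natural_sound:
  assumes "natural A B" "capture_free A"
  shows "A \<turnstile> B \<and> B \<turnstile> A"
  using assms(1)
proof cases
  case (poll_down \<Phi> \<Xi>)
  then show ?thesis
    using pollinable_equivalent assms(2) by blast
next
  case (poll_up \<Phi> \<Xi>)
  then show ?thesis
    using pollinable_equivalent assms(2) by blast
next
  case epis
  then show ?thesis
    using epis_equivalent by blast
next
  case (epet \<gamma> \<Delta>)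
  have "forces_garden w e ({||} \<cdot> {#})" if "evaluation K w e" for w and e :: "'a \<Rightarrow> 'm"
    using that by auto
  then show ?thesis
    using epet by (cases \<gamma>) (auto simp: entails_in_def forces_flower_variant simp del: forces_garden.simps)
next
  case srep
  then show ?thesis
    using srep_equivalent assms(2) by blast
next
  \<comment> \<open>The added flower follows from the retained original; the other direction merely
    drops it.\<close>
  case (ipis \<sigma> y \<Phi> \<Delta> x)
  then show ?thesis
    using forces_pistil_instance[OF ipis(3,4), of x] by (auto simp: entails_in_def)
next
  case ipet
  then show ?thesis
    using ipet_equivalent by blast
qed

lemma cultural_sound:
  assumes "cultural A B"
  shows "B \<turnstile> A"
  using assms
proof cases
  case (grow \<Xi> \<Phi>)
  then show ?thesis
    using entails_in_fill(1)[OF entails_in_empty] by blast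
next
  case (crop \<Xi> \<Phi>)
  then show ?thesis
    using entails_in_fill(2)[OF entails_in_empty] by blast
next
  case (pull \<Xi> \<gamma> \<Gamma> \<Delta>)
  then show ?thesis
    using entails_in_fill(1)[OF corolla_entails[of \<Delta> "\<Gamma> + \<Delta>"]] by simp
next
  case (glue \<Xi> \<gamma> \<Delta> \<Gamma>)
  then show ?thesis
    using entails_in_fill(2)[OF corolla_entails[of \<Delta> "\<Gamma> + \<Delta>"]] by simp
next
  case apis
  then show ?thesis
    using entails_in_fill(1)[OF forces_pistil_instance] by blast
next
  case apet
  then show ?thesis
    using entails_in_fill(2)[OF ipet_equivalent(3)] by blast
qed

lemma step_sound:
  assumes "step ar \<Phi> \<Psi>"
  shows "\<Psi> \<turnstile> \<Phi>"
proof -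
  obtain \<Phi>' \<Psi>' where *: "alpha_equiv \<Phi> \<Phi>'" "capture_free \<Phi>'" "rule_step \<Phi>' \<Psi>'" "alpha_equiv \<Psi>' \<Psi>"
    using assms unfolding step_def by blast
  have "\<Psi>' \<turnstile> \<Phi>'"
    using *(3)
  proof cases
    case (natural_step A B \<Xi>)
    \<comment> \<open>Capture freeness of the whole conclusion descends to the redex, where
      pollination and \<open>srep\<close> call for it.\<close>
    then have "capture_free A"
      using *(2) capture_free_fill(1) by blast
    then show ?thesis
      using natural_step natural_sound equivalent_fill by blast
  next
    case cultural_step
    then show ?thesis
      by (rule cultural_sound)
  qed
  with alpha_equiv_sound[OF *(1)] alpha_equiv_sound[OF *(4)] show ?thesis
    by (blast intro: entails_in_trans)
qed

lemma steps_sound: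
  assumes "steps ar \<Phi> \<Psi>"
  shows "\<Psi> \<turnstile> \<Phi>"
  using assms
proof induction
  case base
  then show ?case
    by (simp add: entails_in_refl)
next
  case (step \<Psi> \<Theta>)
  then show ?case
    using step_sound[of \<Psi> \<Theta>] by (blast intro: entails_in_trans)
qed

end

theorem mainTheorem3:
  fixes ar :: "'p::countable \<Rightarrow> nat"
    and \<Phi> \<Psi> :: "('v::countable, 'p) bouquet"
  assumes "admissible ar \<Phi>" and "admissible ar \<Psi>"
    and "steps ar \<Phi> \<Psi>"
  shows "entails TYPE('w) TYPE('m) ar \<Psi> \<Phi>"
proof -
  have "forces K w e \<Phi>"
    if "kripke_structure ar K" "w \<in> worlds K" "evaluation K w e" "forces K w e \<Psi>"
    for K :: "('w, 'm, 'p) kripke" and w e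
  proof -
    interpret kripke_model ar K
      by unfold_locales (rule that(1))
    show ?thesis
      using steps_sound[OF assms(3)] that by (auto simp: entails_in_def)
  qed
  then show ?thesis
    unfolding entails_def by blast
qed

end
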